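(* Let $\Gamma$ be a connected sesqui-regular graph with parameters $(n,k,c)$ and smallest eigenvalue $\lambda_{\min}(\Gamma)\in[-3,-2)$. (i) If $c=k$, then $n\geq 6$ and $\Gamma$ is the complete multipartite graph $K_{\frac{n}{3}\times 3}$, that is, the complement of the disjoint union of cycles with length $3$. (ii) If $c=k-1$, then $n\geq 7$ and $\Gamma$ is the complement of the disjoint union of cycles with length at least $4$, or is the $3$-cube. In particular, $\Gamma$ is $1$-integrable when $c=k$ or $c=k-1$.
   Context: All graphs are finite, undirected and simple; eigenvalues of a graph are the eigenvalues of its adjacency matrix, and $\lambda_{\min}(\Gamma)$ is the smallest one. A regular graph with $n$ vertices and valency $k$ is sesqui-regular with parameters $(n,k,c)$ if any two vertices at distance $2$ have exactly $c$ common neighbors. $K_{\frac{n}{3}\times 3}$ denotes the complete multipartite graph with $n/3$ parts, each of size $3$. For a positive integer $s$, a graph $\Gamma$ is $s$-integrable if to each vertex $x$ of $\Gamma$ one can assign an integral vector $\mathbf{x}$ (all in a common $\mathbb{Z}^m$) such that, with the standard inner product, $(\mathbf{x},\mathbf{y})=s\lceil-\lambda_{\min}(\Gamma)\rceil$ if $x=y$, $(\mathbf{x},\mathbf{y})=s$ if $x$ is adjacent to $y$, and $(\mathbf{x},\mathbf{y})=0$ otherwise. *)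

theory Defs
  imports
    "Graph_Theory.Graph_Theory"
    "Jordan_Normal_Form.Char_Poly"
    "HOL-Library.Countable_Set"
begin

text \<open>
  A finite simple graph is a \<^locale>\<open>pair_graph\<close>: a finite, symmetric, loop-free set of arcs, each
  undirected edge being represented by its two orientations.
\<close>

text \<open>
  Rows and columns follow the bijection \<^term>\<open>from_nat_into (pverts G)\<close> from
  \<^term>\<open>{..<card (pverts G)}\<close> onto the finite vertex set; another enumeration conjugates the matrix
  by a permutation matrix and leaves the eigenvalues unchanged.
\<close>

definition adjacency_matrix :: "'a pair_pre_digraph \<Rightarrow> real mat" where
  "adjacency_matrix G =
     mat (card (pverts G)) (card (pverts G))
       (\<lambda>(i, j). if (from_nat_into (pverts G) i, from_nat_into (pverts G) j) \<in> parcs G then 1 else 0)"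

definition smallest_eigenvalue :: "'a pair_pre_digraph \<Rightarrow> real" where
  "smallest_eigenvalue G = Min {\<theta>. eigenvalue (adjacency_matrix G) \<theta>}"

definition graph_distance :: "'a pair_pre_digraph \<Rightarrow> 'a \<Rightarrow> 'a \<Rightarrow> ereal" where
  "graph_distance G x y = wf_digraph.\<mu> (with_proj G) (\<lambda>_. 1) x y"

definition common_neighbors :: "'a pair_pre_digraph \<Rightarrow> 'a \<Rightarrow> 'a \<Rightarrow> 'a set" where
  "common_neighbors G x y = {z \<in> pverts G. (x, z) \<in> parcs G \<and> (y, z) \<in> parcs G}"

definition sesqui_regular :: "'a pair_pre_digraph \<Rightarrow> nat \<Rightarrow> nat \<Rightarrow> nat \<Rightarrow> bool" where
  "sesqui_regular G n k c \<longleftrightarrow>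
     card (pverts G) = n \<and>
     (\<forall>x \<in> pverts G. out_degree (with_proj G) x = k) \<and>
     (\<forall>x \<in> pverts G. \<forall>y \<in> pverts G.
        graph_distance G x y = 2 \<longrightarrow> card (common_neighbors G x y) = c)"

definition s_integrable :: "nat \<Rightarrow> 'a pair_pre_digraph \<Rightarrow> bool" where
  "s_integrable s G \<longleftrightarrow> 0 < s \<and>
     (\<exists>m. \<exists>f :: 'a \<Rightarrow> int vec.
        (\<forall>x \<in> pverts G. f x \<in> carrier_vec m) \<and>
        (\<forall>x \<in> pverts G. \<forall>y \<in> pverts G.
           f x \<bullet> f y =
             (if x = y then int s * \<lceil>- smallest_eigenvalue G\<rceil>
              else if (x, y) \<in> parcs G then int s
              else 0)))"

abbreviation graph_iso :: "'a pair_pre_digraph \<Rightarrow> 'b pair_pre_digraph \<Rightarrow> bool" where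
  "graph_iso G H \<equiv> digraph_iso (with_proj G) (with_proj H)"

definition graph_complement :: "'a pair_pre_digraph \<Rightarrow> 'a pair_pre_digraph" where
  "graph_complement G =
     \<lparr>pverts = pverts G,
      parcs = {(x, y). x \<in> pverts G \<and> y \<in> pverts G \<and> x \<noteq> y \<and> (x, y) \<notin> parcs G}\<rparr>"

definition disjoint_union :: "'a pair_pre_digraph list \<Rightarrow> (nat \<times> 'a) pair_pre_digraph" where
  "disjoint_union Gs =
     \<lparr>pverts = {(i, x). i < length Gs \<and> x \<in> pverts (Gs ! i)},
      parcs = {((i, x), (j, y)). i < length Gs \<and> j = i \<and> (x, y) \<in> parcs (Gs ! i)}\<rparr>"

text \<open>Meaningful for \<open>l \<ge> 3\<close> only.\<close>

definition cycle_graph :: "nat \<Rightarrow> nat pair_pre_digraph" where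
  "cycle_graph l =
     \<lparr>pverts = {..<l},
      parcs = {(i, j). i < l \<and> j < l \<and> (j = (i + 1) mod l \<or> i = (j + 1) mod l)}\<rparr>"

text \<open>\<open>p\<close> parts of size \<open>t\<close>; the first coordinate of a vertex names its part.\<close>

definition complete_multipartite :: "nat \<Rightarrow> nat \<Rightarrow> (nat \<times> nat) pair_pre_digraph" where
  "complete_multipartite p t =
     \<lparr>pverts = {..<p} \<times> {..<t},
      parcs = {(u, v). u \<in> {..<p} \<times> {..<t} \<and> v \<in> {..<p} \<times> {..<t} \<and> fst u \<noteq> fst v}\<rparr>"

definition hypercube :: "nat \<Rightarrow> bool list pair_pre_digraph" where
  "hypercube d =
     \<lparr>pverts = {u. length u = d},
      parcs = {(u, v). length u = d \<and> length v = d \<and> card {i. i < d \<and> u ! i \<noteq> v ! i} = 1}\<rparr>"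

end

theory Submission
  imports Defs
begin

text \<open>
  Let \<open>N(x)\<close> be the set of neighbours of \<open>x\<close> and \<open>\<theta>\<close> the smallest eigenvalue. All
  eigenvalues are at most \<open>k\<close> in absolute value, so \<open>\<theta> < -2\<close> gives \<open>k \<ge> 3\<close>. Upper bounds on \<open>\<theta>\<close>
  come from explicit eigenfunctions, lower bounds from solving the eigenvalue equations by hand.

  If \<open>c = k\<close>, then nonadjacent vertices have the same neighbours (\<open>neighbors_eq\<close>). Such a complete
  multipartite graph has smallest eigenvalue \<open>k - n\<close> (\<open>multipartite_smallest_eigenvalue\<close>), so
  all parts have size three.

  If \<open>c = k - 1\<close> and some two nonadjacent vertices have no common neighbour, then there are \<open>x\<close> and \<open>z\<close> at
  distance three, and every vertex of \<open>N(x)\<close> is adjacent to all but one vertex of \<open>N(z)\<close> and vice versa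
  (\<open>antipodal\<close>). The graph is \<open>K\<^bsub>k+1,k+1\<^esub>\<close> minus a perfect matching; being bipartite it has the eigenvalue
  \<open>-k\<close>, so \<open>k = 3\<close> and it is the cube.

  If \<open>c = k - 1\<close> and the diameter is two, then each non-neighbour \<open>y\<close> of \<open>x\<close> has a single neighbour
  among the non-neighbours of \<open>x\<close> (\<open>matching\<close>). With three or more non-neighbours per vertex, the components of the
  complement are complete multipartite with parts of size two, and two of them yield an
  eigenvalue at most \<open>-4\<close> (\<open>card_non_neighbors_le_2\<close>). So every vertex has exactly two non-neighbours,
  and these are adjacent: the complement is two-regular without triangles, a disjoint union of cycles of length
  at least four (\<open>cycle_decomposition\<close>). Having at most six vertices would leave the complement of the hexagon,
  whose smallest eigenvalue is only \<open>-2\<close>.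

  For integrability, \<open>A + 3I\<close> must be a Gram matrix of integral vectors. For the cube it is the Gram matrix of
  the edge incidence vectors; for the complement of cycles it is the all-ones matrix plus the
  Laplacian of the cycles.
\<close>

section \<open>Neighbourhoods, connectedness and distance two\<close>

definition neighbors :: "'a pair_pre_digraph \<Rightarrow> 'a \<Rightarrow> 'a set" where
  "neighbors G x = {y. (x, y) \<in> parcs G}"

definition non_neighbors :: "'a pair_pre_digraph \<Rightarrow> 'a \<Rightarrow> 'a set" where
  "non_neighbors G x = pverts G - neighbors G x - {x}"

context pair_graph
begin

lemma neighbors_subset: "neighbors G x \<subseteq> pverts G"
  using in_arcsD2 by (auto simp: neighbors_def)

lemma finite_neighbors [simp]: "finite (neighbors G x)"
  using neighbors_subset pair_finite_verts finite_subset by blast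

lemma finite_non_neighbors [simp]: "finite (non_neighbors G x)"
  using pair_finite_verts by (simp add: non_neighbors_def)

lemma neighbors_sym: "y \<in> neighbors G x \<longleftrightarrow> x \<in> neighbors G y"
  using pair_sym_arcs by (auto simp: neighbors_def symmetric_def sym_def)

lemma neighbors_irrefl [simp]: "x \<notin> neighbors G x"
  using pair_no_loops by (force simp: neighbors_def)

lemma non_neighbors_sym:
  "x \<in> pverts G \<Longrightarrow> y \<in> non_neighbors G x \<Longrightarrow> x \<in> non_neighbors G y"
  using neighbors_sym by (auto simp: non_neighbors_def)

lemma out_degree_eq_card_neighbors: "out_degree (with_proj G) x = card (neighbors G x)"
proof -
  have "out_arcs (with_proj G) x = Pair x ` neighbors G x"
    by (auto simp: out_arcs_def neighbors_def)
  then show ?thesis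
    by (simp add: out_degree_def card_image inj_on_def)
qed

lemma common_neighbors_eq: "common_neighbors G x y = neighbors G x \<inter> neighbors G y"
  using neighbors_subset by (auto simp: common_neighbors_def neighbors_def)

lemma card_non_neighbors:
  assumes "x \<in> pverts G"
  shows "card (pverts G) = card (neighbors G x) + card (non_neighbors G x) + 1"
proof -
  have "pverts G = insert x (neighbors G x \<union> non_neighbors G x)"
    using assms neighbors_subset by (auto simp: non_neighbors_def)
  moreover have "x \<notin> neighbors G x \<union> non_neighbors G x"
    by (simp add: non_neighbors_def)
  moreover have "neighbors G x \<inter> non_neighbors G x = {}"
    by (auto simp: non_neighbors_def)
  ultimately show ?thesis
    by (metis Suc_eq_plus1 card_Un_disjoint card_insert_disjoint finite_UnI
        finite_neighbors finite_non_neighbors)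
qed

text \<open>
  The common neighbour gives a walk of cost two; a cheaper walk would be empty or a single arc.
\<close>

lemma graph_distance_eq_2:
  assumes "x \<noteq> y" "y \<notin> neighbors G x" "z \<in> neighbors G x" "z \<in> neighbors G y"
  shows "graph_distance G x y = 2"
proof -
  have "awalk x [(x, z), (z, y)] y"
    using assms neighbors_sym neighbors_subset
    by (auto simp: awalk_simps neighbors_def in_arcsD2)
  moreover have "2 \<le> awalk_cost (\<lambda>_. 1) p" if "awalk x p y" for p
  proof (cases p)
    case Nil
    with that assms show ?thesis by (auto simp: awalk_simps)
  next
    case (Cons e q)
    show ?thesis
    proof (cases q)
      case Nil
      with that assms Cons show ?thesis
        by (auto simp: awalk_simps neighbors_def)
    next
      case (Cons e' q')
      with \<open>p = e # q\<close> show ?thesis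
        by (auto simp: awalk_cost_def intro!: sum_list_nonneg)
    qed
  qed
  ultimately have "\<mu> (\<lambda>_. 1) x y = ereal (awalk_cost (\<lambda>_. 1) [(x, z), (z, y)])"
    by (intro antisym min_cost_le_walk_cost) (auto simp: \<mu>_def awalk_cost_def intro!: INF_greatest)
  then have "\<mu> (\<lambda>_. 1) x y = 2" by (simp add: awalk_cost_def)
  then show ?thesis by (simp add: graph_distance_def)
qed

text \<open>
  The form in which connectedness is used: vertices related to a chosen vertex in a certain way
  are shown to be closed under adjacency, so that every vertex is related to it in this way.
\<close>

lemma connected_closed_set:
  assumes "Digraph_Component.connected (with_proj G)"
    and "S \<subseteq> pverts G" "S \<noteq> {}" "\<And>x. x \<in> S \<Longrightarrow> neighbors G x \<subseteq> S"
  shows "S = pverts G"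
proof -
  obtain s where s: "s \<in> S" using assms(3) by blast
  have "v \<in> S" if "v \<in> pverts G" for v
  proof -
    have "reachable (with_proj G) s v"
      using assms(1,2) s that reachable_mk_symmetric_eq[OF pair_sym_arcs]
      by (auto simp: Digraph_Component.connected_def strongly_connected_def)
    then show "v \<in> S"
      by (induction rule: reachable_induct)
        (use s assms(4) in \<open>auto simp: neighbors_def\<close>)
  qed
  then show ?thesis using assms(2) by blast
qed

end

section \<open>Eigenvalues as eigenfunctions on the vertices\<close>

text \<open>
  An eigenvector of the adjacency matrix, read as a function on the vertices and thus
  independent of their enumeration.
\<close>

definition eigenfunction :: "'a pair_pre_digraph \<Rightarrow> real \<Rightarrow> ('a \<Rightarrow> real) \<Rightarrow> bool" where
  "eigenfunction G \<theta> u \<longleftrightarrow>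
     (\<exists>x \<in> pverts G. u x \<noteq> 0) \<and> (\<forall>x \<in> pverts G. (\<Sum>y \<in> neighbors G x. u y) = \<theta> * u x)"

context pair_graph
begin

lemma adjacency_matrix_mult:
  assumes i: "i < card (pverts G)"
    and v: "v = vec (card (pverts G)) (\<lambda>i. u (from_nat_into (pverts G) i))"
  shows "(adjacency_matrix G *\<^sub>v v) $ i = (\<Sum>y \<in> neighbors G (from_nat_into (pverts G) i). u y)"
proof -
  let ?n = "card (pverts G)" and ?e = "from_nat_into (pverts G)"
  have bij: "bij_betw ?e {..<?n} (pverts G)"
    by (rule bij_betw_from_nat_into_finite[OF pair_finite_verts])
  have "(adjacency_matrix G *\<^sub>v v) $ i
      = (\<Sum>j<?n. (if (?e i, ?e j) \<in> parcs G then 1 else 0) * u (?e j))"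
    using i by (simp add: adjacency_matrix_def v scalar_prod_def atLeast0LessThan)
  also have "\<dots> = (\<Sum>y\<in>pverts G. (if (?e i, y) \<in> parcs G then 1 else 0) * u y)"
    by (rule sum.reindex_bij_betw[OF bij])
  also have "\<dots> = (\<Sum>y\<in>neighbors G (?e i). (if (?e i, y) \<in> parcs G then 1 else 0) * u y)"
    by (rule sum.mono_neutral_right)
      (use pair_finite_verts neighbors_subset in \<open>auto simp: neighbors_def\<close>)
  also have "\<dots> = (\<Sum>y\<in>neighbors G (?e i). u y)"
    by (rule sum.cong) (auto simp: neighbors_def)
  finally show ?thesis .
qed

lemma eigenvalue_iff_eigenfunction:
  "eigenvalue (adjacency_matrix G) \<theta> \<longleftrightarrow> (\<exists>u. eigenfunction G \<theta> u)"
proof -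
  let ?n = "card (pverts G)" and ?e = "from_nat_into (pverts G)"
  have dim: "dim_row (adjacency_matrix G) = ?n" by (simp add: adjacency_matrix_def)
  have bij: "bij_betw ?e {..<?n} (pverts G)"
    by (rule bij_betw_from_nat_into_finite[OF pair_finite_verts])
  have all: "(\<forall>x\<in>pverts G. P x) \<longleftrightarrow> (\<forall>i<?n. P (?e i))" for P
    using bij by (force simp: bij_betw_def)
  have *: "eigenvector (adjacency_matrix G) v \<theta> \<longleftrightarrow> eigenfunction G \<theta> u"
    if v: "v = vec ?n (\<lambda>i. u (?e i))" for u v
  proof -
    have "v \<noteq> 0\<^sub>v ?n \<longleftrightarrow> (\<exists>x\<in>pverts G. u x \<noteq> 0)"
      using all[of "\<lambda>x. u x = 0"] by (auto simp: v vec_eq_iff)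
    moreover have "adjacency_matrix G *\<^sub>v v = \<theta> \<cdot>\<^sub>v v
        \<longleftrightarrow> (\<forall>x \<in> pverts G. (\<Sum>y \<in> neighbors G x. u y) = \<theta> * u x)"
      unfolding all using adjacency_matrix_mult[OF _ v]
      by (auto simp: vec_eq_iff dim v simp del: index_mult_mat_vec)
    moreover have "v \<in> carrier_vec ?n" by (simp add: v)
    ultimately show ?thesis
      unfolding eigenvector_def eigenfunction_def dim by blast
  qed
  show ?thesis
  proof
    assume "eigenvalue (adjacency_matrix G) \<theta>"
    then obtain v where v: "eigenvector (adjacency_matrix G) v \<theta>"
      by (auto simp: eigenvalue_def)
    define u where "u x = v $ the_inv_into {..<?n} ?e x" for x
    have "v = vec ?n (\<lambda>i. u (?e i))"
      using v bij
      by (auto simp: eigenvector_def dim u_def vec_eq_iff bij_betw_def the_inv_into_f_f)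
    with * v show "\<exists>u. eigenfunction G \<theta> u" by blast
  next
    assume "\<exists>u. eigenfunction G \<theta> u"
    with * show "eigenvalue (adjacency_matrix G) \<theta>" by (auto simp: eigenvalue_def)
  qed
qed

lemma finite_eigenvalues: "finite {\<theta>. eigenvalue (adjacency_matrix G) \<theta>}"
proof -
  let ?n = "card (pverts G)"
  have A: "adjacency_matrix G \<in> carrier_mat ?n ?n" by (simp add: adjacency_matrix_def)
  have "char_poly (adjacency_matrix G) \<noteq> 0"
    using degree_monic_char_poly[OF A] by auto
  from poly_roots_finite[OF this] show ?thesis
    by (simp add: eigenvalue_root_char_poly[OF A])
qed

lemma smallest_eigenvalue_le:
  "eigenfunction G \<theta> u \<Longrightarrow> smallest_eigenvalue G \<le> \<theta>"
  unfolding smallest_eigenvalue_def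
  by (rule Min_le[OF finite_eigenvalues]) (use eigenvalue_iff_eigenfunction in blast)

end

locale regular_graph = pair_graph G for G :: "'a pair_pre_digraph" +
  fixes k :: nat
  assumes regular: "x \<in> pverts G \<Longrightarrow> card (neighbors G x) = k"
    and nonempty: "pverts G \<noteq> {}"
begin

text \<open>
  The all-ones function belongs to the eigenvalue \<open>k\<close>, so the spectrum is nonempty and its
  minimum is attained.
\<close>

lemma smallest_eigenvalue_eigenfunction:
  obtains u where "eigenfunction G (smallest_eigenvalue G) u"
proof -
  have "eigenfunction G (real k) (\<lambda>_. 1)"
    using nonempty by (auto simp: eigenfunction_def regular)
  then have "{\<theta>. eigenvalue (adjacency_matrix G) \<theta>} \<noteq> {}"
    using eigenvalue_iff_eigenfunction by blast
  from Min_in[OF finite_eigenvalues this] show ?thesis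
    using that eigenvalue_iff_eigenfunction by (auto simp: smallest_eigenvalue_def)
qed

text \<open>
  Evaluate the eigenvalue equation at a vertex where \<open>\<bar>u\<bar>\<close> is largest.
\<close>

lemma abs_eigenvalue_le_valency:
  assumes "eigenfunction G \<theta> u"
  shows "\<bar>\<theta>\<bar> \<le> k"
proof -
  have "Max ((\<lambda>y. \<bar>u y\<bar>) ` pverts G) \<in> (\<lambda>y. \<bar>u y\<bar>) ` pverts G"
    using nonempty pair_finite_verts by (intro Max_in) auto
  then obtain x where x: "x \<in> pverts G" "Max ((\<lambda>y. \<bar>u y\<bar>) ` pverts G) = \<bar>u x\<bar>" by blast
  have max: "\<bar>u y\<bar> \<le> \<bar>u x\<bar>" if "y \<in> pverts G" for y
    using that pair_finite_verts by (simp add: x(2)[symmetric])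
  obtain x' where "x' \<in> pverts G" "u x' \<noteq> 0"
    using assms by (auto simp: eigenfunction_def)
  with max[of x'] have pos: "\<bar>u x\<bar> > 0" by linarith
  have "\<bar>\<theta>\<bar> * \<bar>u x\<bar> = \<bar>\<Sum>y \<in> neighbors G x. u y\<bar>"
    using assms x(1) by (simp add: eigenfunction_def abs_mult)
  also have "\<dots> \<le> (\<Sum>y \<in> neighbors G x. \<bar>u y\<bar>)" by (rule sum_abs)
  also have "\<dots> \<le> (\<Sum>y \<in> neighbors G x. \<bar>u x\<bar>)"
    by (rule sum_mono) (use max neighbors_subset in blast)
  also have "\<dots> = k * \<bar>u x\<bar>" using regular[OF x(1)] by simp
  finally show ?thesis using pos by simp
qed

text \<open>
  If nonadjacent vertices have the same neighbours, the vertices fall into classes of \<open>n - k\<close>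
  mutually nonadjacent ones. For \<open>\<theta> \<noteq> 0\<close> the eigenvalue equation makes \<open>u\<close> constant on each class and
  turns into \<open>(\<theta> + n - k) u(x) = S\<close> with the same total \<open>S\<close> at every vertex \<open>x\<close>. Hence \<open>\<theta> = k - n\<close>, or \<open>u\<close>
  is constant and \<open>\<theta> = k\<close>. Classes of size one are included, which covers complete graphs.
\<close>

lemma multipartite_smallest_eigenvalue:
  assumes nbrs: "\<And>x y. x \<in> pverts G \<Longrightarrow> y \<in> non_neighbors G x \<Longrightarrow> neighbors G y = neighbors G x"
    and neg: "smallest_eigenvalue G < 0"
  shows "smallest_eigenvalue G = real k - real (card (pverts G))"
proof -
  let ?\<theta> = "smallest_eigenvalue G" and ?V = "pverts G"
  obtain u where u: "eigenfunction G ?\<theta> u" by (rule smallest_eigenvalue_eigenfunction)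
  then have ev: "(\<Sum>y \<in> neighbors G x. u y) = ?\<theta> * u x" if "x \<in> ?V" for x
    using that by (simp add: eigenfunction_def)
  define S where "S = sum u ?V"
  have const: "S = (?\<theta> + (real (card ?V) - real k)) * u x" if x: "x \<in> ?V" for x
  proof -
    have "u y = u x" if "y \<in> non_neighbors G x" for y
    proof -
      have "y \<in> ?V" using that by (simp add: non_neighbors_def)
      then have "?\<theta> * u y = ?\<theta> * u x" using ev nbrs[OF x that] x by metis
      with neg show ?thesis by simp
    qed
    then have "sum u (non_neighbors G x) = card (non_neighbors G x) * u x" by simp
    moreover have "S = sum u (neighbors G x) + sum u (non_neighbors G x) + u x"
    proof -
      have "?V = insert x (neighbors G x \<union> non_neighbors G x)"
        using x neighbors_subset by (auto simp: non_neighbors_def)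
      moreover have "x \<notin> neighbors G x \<union> non_neighbors G x"
        "neighbors G x \<inter> non_neighbors G x = {}"
        by (auto simp: non_neighbors_def)
      ultimately show ?thesis
        by (simp add: S_def sum.union_disjoint)
    qed
    moreover have "real (card (non_neighbors G x)) = real (card ?V) - real k - 1"
      using card_non_neighbors[OF x] regular[OF x] by simp
    ultimately show ?thesis using ev[OF x] by (simp add: algebra_simps)
  qed
  show ?thesis
  proof (rule ccontr)
    assume "?\<theta> \<noteq> real k - real (card ?V)"
    then have ne: "?\<theta> + (real (card ?V) - real k) \<noteq> 0" by auto
    obtain x where x: "x \<in> ?V" "u x \<noteq> 0" using u by (auto simp: eigenfunction_def)
    have "u y = u x" if "y \<in> ?V" for y
      using const[OF that] const[OF x(1)] ne by simp
    then have "sum u (neighbors G x) = (\<Sum>y \<in> neighbors G x. u x)"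
      using neighbors_subset by (intro sum.cong) auto
    also have "\<dots> = k * u x"
      using regular[OF x(1)] by simp
    finally have "?\<theta> = k" using ev[OF x(1)] x(2) by simp
    with neg show False by simp
  qed
qed

end

section \<open>Two-regular relations are disjoint unions of cycles\<close>

text \<open>
  The modular conditions are those of \<^const>\<open>cycle_graph\<close>; they describe the whole of \<open>R (ps ! i)\<close>,
  so that the listed cycle is a connected component of \<open>R\<close>.
\<close>

definition cyclic_listing :: "('a \<Rightarrow> 'a set) \<Rightarrow> 'a list \<Rightarrow> bool" where
  "cyclic_listing R ps \<longleftrightarrow> distinct ps \<and> 3 \<le> length ps \<and>
     (\<forall>i<length ps. R (ps ! i) =
        {ps ! j |j. j < length ps \<and> (j = (i + 1) mod length ps \<or> i = (j + 1) mod length ps)})"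

lemma cyclic_listing_closed:
  "cyclic_listing R ps \<Longrightarrow> x \<in> set ps \<Longrightarrow> R x \<subseteq> set ps"
  by (auto simp: cyclic_listing_def in_set_conv_nth)

lemma cyclic_listing_mem_iff:
  assumes "cyclic_listing R ps" "i < length ps" "j < length ps"
  shows "ps ! j \<in> R (ps ! i) \<longleftrightarrow> j = (i + 1) mod length ps \<or> i = (j + 1) mod length ps"
proof -
  have "R (ps ! i) =
      {ps ! j |j. j < length ps \<and> (j = (i + 1) mod length ps \<or> i = (j + 1) mod length ps)}"
    and "distinct ps"
    using assms by (simp_all add: cyclic_listing_def)
  then show ?thesis using assms(3) by (auto simp: nth_eq_iff_index_eq)
qed

lemma two_element_set:
  assumes "card S = 2" "a \<in> S" "b \<in> S" "a \<noteq> b"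
  shows "S = {a, b}"
  using assms by (auto simp: card_2_iff)

locale two_regular_relation =
  fixes V :: "'a set" and R :: "'a \<Rightarrow> 'a set"
  assumes finite_V: "finite V"
    and R_subset: "x \<in> V \<Longrightarrow> R x \<subseteq> V"
    and R_card: "x \<in> V \<Longrightarrow> card (R x) = 2"
    and R_irrefl: "x \<in> V \<Longrightarrow> x \<notin> R x"
    and R_sym: "x \<in> V \<Longrightarrow> y \<in> R x \<Longrightarrow> x \<in> R y"
begin

text \<open>
  A longest path closes up to a cycle: the second neighbour of its last vertex lies on the path
  by maximality, and no inner vertex of the path has a neighbour left to offer.
\<close>

lemma ex_cyclic_listing:
  assumes "V \<noteq> {}"
  obtains ps where "cyclic_listing R ps" "set ps \<subseteq> V"
proof -
  define P where "P ps \<longleftrightarrow> ps \<noteq> [] \<and> distinct ps \<and> set ps \<subseteq> V \<and>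
    (\<forall>i. Suc i < length ps \<longrightarrow> ps ! Suc i \<in> R (ps ! i))" for ps
  obtain x where x: "x \<in> V" using assms by blast
  have "P [x]" using x by (simp add: P_def)
  moreover have "length ps < Suc (card V)" if "P ps" for ps
  proof -
    have "length ps = card (set ps)" using that by (simp add: P_def distinct_card)
    also have "\<dots> \<le> card V" using that finite_V by (auto simp: P_def intro: card_mono)
    finally show ?thesis by simp
  qed
  ultimately obtain ps where ps: "P ps" and max: "\<And>qs. P qs \<Longrightarrow> length qs \<le> length ps"
    using ex_has_greatest_nat[of P "[x]" length "Suc (card V)"] by auto
  define l where "l = length ps"
  have dist: "distinct ps" and sub: "set ps \<subseteq> V" and l0: "l > 0"
    and step: "\<And>i. Suc i < l \<Longrightarrow> ps ! Suc i \<in> R (ps ! i)"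
    using ps by (auto simp: P_def l_def)
  have V: "ps ! i \<in> V" if "i < l" for i using sub that by (auto simp: l_def)
  have backstep: "ps ! i \<in> R (ps ! Suc i)" if "Suc i < l" for i
    using R_sym[OF V step] that by simp
  have neq: "ps ! i = ps ! j \<longleftrightarrow> i = j" if "i < l" "j < l" for i j
    using dist that by (simp add: nth_eq_iff_index_eq l_def)
  let ?z = "ps ! (l - 1)"
  \<comment> \<open>A neighbour of the last vertex outside the path would extend it.\<close>
  have last_closed: "R ?z \<subseteq> set ps"
  proof
    fix y assume y: "y \<in> R ?z"
    show "y \<in> set ps"
    proof (rule ccontr)
      assume "y \<notin> set ps"
      moreover have "y \<in> V" using y R_subset[OF V[of "l - 1"]] l0 by auto
      moreover have "(ps @ [y]) ! Suc i \<in> R ((ps @ [y]) ! i)" if "Suc i < Suc l" for i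
      proof (cases "Suc i < l")
        case True
        then show ?thesis using step by (simp add: nth_append l_def)
      next
        case False
        with that have "Suc i = l" by simp
        then have "(ps @ [y]) ! Suc i = y" "(ps @ [y]) ! i = ?z"
          by (auto simp: nth_append l_def dest: sym)
        then show ?thesis using y by simp
      qed
      ultimately have "P (ps @ [y])"
        using dist sub by (simp add: P_def l_def)
      from max[OF this] show False by simp
    qed
  qed
  have "card (R ?z) = 2" using R_card V l0 by simp
  moreover have "R ?z \<subseteq> set ps - {?z}" using last_closed R_irrefl V l0 by auto
  then have "card (R ?z) \<le> card (set ps - {?z})" by (intro card_mono) auto
  moreover have "card (set ps - {?z}) = l - 1"
    using l0 dist by (simp add: distinct_card l_def)
  ultimately have l3: "3 \<le> l" by linarith
  have inner: "R (ps ! Suc i) = {ps ! i, ps ! Suc (Suc i)}" if "Suc (Suc i) < l" for i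
    using that neq[of i "Suc (Suc i)"]
    by (intro two_element_set R_card V backstep step) auto
  obtain p where p: "p \<in> R ?z" "p \<noteq> ps ! (l - 2)"
    using \<open>card (R ?z) = 2\<close> by (auto simp: card_2_iff)
  obtain j where j: "j < l" "p = ps ! j"
    using p(1) last_closed by (metis in_set_conv_nth l_def subsetD)
  have jl: "j \<noteq> l - 2" using p j by auto
  have jl1: "j \<noteq> l - 1" using p(1) j R_irrefl[OF V[of "l - 1"]] l0 by auto
  have j0: "j = 0"
  proof (cases j)
    case (Suc i)
    then have si: "Suc (Suc i) < l" using j jl1 by linarith
    have "?z \<in> R (ps ! j)" using R_sym[OF V[of "l - 1"], of p] p(1) j l0 by simp
    then have "?z = ps ! i \<or> ?z = ps ! Suc (Suc i)" using inner[OF si] Suc by simp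
    then have "l - 1 = i \<or> l - 1 = Suc (Suc i)"
      using neq[of "l - 1" i] neq[of "l - 1" "Suc (Suc i)"] si by simp
    then show ?thesis using si jl Suc by linarith
  qed
  have last: "R ?z = {ps ! (l - 2), ps ! 0}"
  proof (rule two_element_set)
    show "ps ! (l - 2) \<in> R ?z"
      using backstep[of "l - 2"] l3 by (simp add: numeral_2_eq_2 Suc_diff_Suc)
    show "ps ! (l - 2) \<noteq> ps ! 0" using neq[of "l - 2" 0] l3 by simp
  qed (use p j j0 \<open>card (R ?z) = 2\<close> in auto)
  have first: "R (ps ! 0) = {ps ! (l - 1), ps ! 1}"
  proof (rule two_element_set)
    show "ps ! (l - 1) \<in> R (ps ! 0)" using R_sym[OF V[of "l - 1"]] last l3 by simp
    show "ps ! 1 \<in> R (ps ! 0)" using step[of 0] l3 by simp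
    show "ps ! (l - 1) \<noteq> ps ! 1" using neq[of "l - 1" 1] l3 by simp
  qed (use R_card V l3 in simp)
  have "R (ps ! i) = {ps ! j |j. j < l \<and> (j = (i + 1) mod l \<or> i = (j + 1) mod l)}"
    (is "_ = {ps ! j |j. ?adj i j}") if i: "i < l" for i
  proof -
    have nxt: "(j + 1) mod l = (if j = l - 1 then 0 else j + 1)" if "j < l" for j
      using that l3 by auto
    have adj: "?adj i j \<longleftrightarrow> j < l \<and>
        (j = (if i = l - 1 then 0 else i + 1) \<or> i = (if j = l - 1 then 0 else j + 1))" for j
      using nxt[OF i] nxt[of j] by (cases "j < l") simp_all
    consider "i = 0" | "i = l - 1" "i > 0" | m where "i = Suc m" "Suc (Suc m) < l"
      using i by (cases i) (auto, linarith)
    then show ?thesis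
    proof cases
      case 1
      have "?adj i j \<longleftrightarrow> j = l - 1 \<or> j = 1" for j
        unfolding adj using 1 l3 by (auto split: if_splits)
      then have "{ps ! j |j. ?adj i j} = {ps ! (l - 1), ps ! 1}" by auto
      with first 1 show ?thesis by simp
    next
      case 2
      have "?adj i j \<longleftrightarrow> j = l - 2 \<or> j = 0" for j
        unfolding adj using 2 l3 by (auto split: if_splits)
      then have "{ps ! j |j. ?adj i j} = {ps ! (l - 2), ps ! 0}" by auto
      with last 2 show ?thesis by simp
    next
      case (3 m)
      have "?adj i j \<longleftrightarrow> j = m \<or> j = Suc (Suc m)" for j
        unfolding adj using 3 l3 by (auto split: if_splits)
      then have "{ps ! j |j. ?adj i j} = {ps ! m, ps ! Suc (Suc m)}" by auto
      with inner 3 show ?thesis by simp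
    qed
  qed
  with dist l3 sub show ?thesis
    by (intro that[of ps]) (auto simp: cyclic_listing_def l_def)
qed

end

text \<open>
  Every vertex of a cycle has both its neighbours on that cycle, so removing the cycle leaves a
  smaller two-regular relation.
\<close>

lemma cycle_decomposition:
  assumes "two_regular_relation V R"
  shows "\<exists>pss. distinct (concat pss) \<and> set (concat pss) = V \<and> (\<forall>ps \<in> set pss. cyclic_listing R ps)"
  using assms
proof (induction "card V" arbitrary: V rule: less_induct)
  case less
  interpret two_regular_relation V R by (rule less.prems)
  show ?case
  proof (cases "V = {}")
    case True
    then show ?thesis by (intro exI[of _ "[]"]) simp
  next
    case False
    then obtain ps where ps: "cyclic_listing R ps" "set ps \<subseteq> V"
      by (rule ex_cyclic_listing)
    let ?W = "V - set ps"
    have "ps \<noteq> []" using ps by (auto simp: cyclic_listing_def)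
    then have "card ?W < card V"
      using ps(2) finite_V by (intro psubset_card_mono) (auto simp: neq_Nil_conv)
    moreover have "R x \<subseteq> ?W" if "x \<in> ?W" for x
      using that R_subset R_sym[of x] cyclic_listing_closed[OF ps(1)] by blast
    then have "two_regular_relation ?W R"
      using finite_V R_card R_irrefl R_sym by unfold_locales auto
    ultimately obtain pss where pss: "distinct (concat pss)" "set (concat pss) = ?W"
        "\<forall>ps \<in> set pss. cyclic_listing R ps"
      using less.hyps by blast
    then show ?thesis
      using ps by (intro exI[of _ "ps # pss"]) (auto simp: cyclic_listing_def)
  qed
qed

section \<open>Graph isomorphisms and complements of cycles\<close>

text \<open>
  Arcs are pairs of vertices, so an isomorphism amounts to a bijection of the vertices that
  preserves and reflects arcs.
\<close>

lemma graph_isoI: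
  assumes "pair_wf_digraph G" "bij_betw \<phi> (pverts G) (pverts H)" "pair_wf_digraph H"
    and "\<And>x y. x \<in> pverts G \<Longrightarrow> y \<in> pverts G \<Longrightarrow> (\<phi> x, \<phi> y) \<in> parcs H \<longleftrightarrow> (x, y) \<in> parcs G"
  shows "graph_iso G H"
proof -
  interpret G: pair_wf_digraph G by fact
  interpret H: pair_wf_digraph H by fact
  let ?f = "\<lparr>iso_verts = \<phi>, iso_arcs = map_prod \<phi> \<phi>, iso_head = snd, iso_tail = fst\<rparr>"
  have inj: "inj_on \<phi> (pverts G)" and im: "\<phi> ` pverts G = pverts H"
    using assms(2) by (auto simp: bij_betw_def)
  have "parcs H = map_prod \<phi> \<phi> ` parcs G"
  proof (intro Set.set_eqI iffI)
    fix e assume e: "e \<in> parcs H"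
    then obtain x y where xy: "x \<in> pverts G" "y \<in> pverts G" "e = (\<phi> x, \<phi> y)"
      using H.arc_fst_in_verts H.arc_snd_in_verts im by (metis imageE prod.collapse)
    with e assms(4) have "(x, y) \<in> parcs G" by simp
    with xy show "e \<in> map_prod \<phi> \<phi> ` parcs G" by force
  next
    fix e assume "e \<in> map_prod \<phi> \<phi> ` parcs G"
    then obtain x y where "(x, y) \<in> parcs G" "e = (\<phi> x, \<phi> y)" by auto
    with assms(4) show "e \<in> parcs H" using G.in_arcsD1 G.in_arcsD2 by blast
  qed
  moreover have "pre_digraph.digraph_isomorphism (with_proj G) ?f"
  proof -
    have "inj_on (map_prod \<phi> \<phi>) (parcs G)"
    proof (rule inj_onI, clarsimp)
      fix a b a' b'
      assume "(a, b) \<in> parcs G" "(a', b') \<in> parcs G" "\<phi> a = \<phi> a'" "\<phi> b = \<phi> b'"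
      with inj show "a = a' \<and> b = b'"
        using G.in_arcsD1 G.in_arcsD2 by (meson inj_onD)
    qed
    then show ?thesis
      using inj G.wf_digraph_axioms
      by (auto simp: pre_digraph.digraph_isomorphism_def)
  qed
  ultimately show ?thesis
    using im unfolding digraph_iso_def app_iso_def with_proj_def
    by (intro exI[of _ ?f]) simp
qed

lemma graph_isoE:
  assumes "graph_iso G H" "pair_wf_digraph G"
  obtains \<phi> where "bij_betw \<phi> (pverts G) (pverts H)"
    "\<And>x y. x \<in> pverts G \<Longrightarrow> y \<in> pverts G \<Longrightarrow> (\<phi> x, \<phi> y) \<in> parcs H \<longleftrightarrow> (x, y) \<in> parcs G"
proof -
  interpret G: pair_wf_digraph G by fact
  obtain f where f: "pre_digraph.digraph_isomorphism (with_proj G) f"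
      "with_proj H = app_iso f (with_proj G)"
    using assms by (auto simp: digraph_iso_def)
  have V: "pverts H = iso_verts f ` pverts G" and E: "parcs H = iso_arcs f ` parcs G"
    and t: "iso_tail f = fst" and h: "iso_head f = snd"
    using f(2) by (auto simp: app_iso_def with_proj_def)
  have inj: "inj_on (iso_verts f) (pverts G)"
    using f(1) by (simp add: pre_digraph.digraph_isomorphism_def)
  have arc: "iso_arcs f (x, y) = (iso_verts f x, iso_verts f y)" if "(x, y) \<in> parcs G" for x y
    using f(1) that t h
    by (force simp: pre_digraph.digraph_isomorphism_def prod_eq_iff)
  show ?thesis
  proof (rule that)
    show "bij_betw (iso_verts f) (pverts G) (pverts H)"
      using inj V by (simp add: bij_betw_def)
    fix x y assume xy: "x \<in> pverts G" "y \<in> pverts G"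
    show "(iso_verts f x, iso_verts f y) \<in> parcs H \<longleftrightarrow> (x, y) \<in> parcs G"
    proof
      assume "(iso_verts f x, iso_verts f y) \<in> parcs H"
      then obtain a b where ab: "(a, b) \<in> parcs G" "iso_verts f a = iso_verts f x"
          "iso_verts f b = iso_verts f y"
        using E arc by force
      with inj xy have "a = x" "b = y"
        using G.in_arcsD1 G.in_arcsD2 by (auto dest: inj_onD)
      with ab show "(x, y) \<in> parcs G" by simp
    next
      assume "(x, y) \<in> parcs G"
      then show "(iso_verts f x, iso_verts f y) \<in> parcs H"
        unfolding E using arc by (metis image_eqI)
    qed
  qed
qed

lemma graph_iso_sym:
  assumes "pair_wf_digraph G" "pair_wf_digraph H" "graph_iso G H"
  shows "graph_iso H G"
proof -
  obtain \<phi> where \<phi>: "bij_betw \<phi> (pverts G) (pverts H)"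
    "\<And>x y. x \<in> pverts G \<Longrightarrow> y \<in> pverts G \<Longrightarrow> (\<phi> x, \<phi> y) \<in> parcs H \<longleftrightarrow> (x, y) \<in> parcs G"
    using graph_isoE[OF assms(3,1)] by blast
  show ?thesis
  proof (rule graph_isoI[OF assms(2) bij_betw_the_inv_into[OF \<phi>(1)] assms(1)])
    let ?\<psi> = "the_inv_into (pverts G) \<phi>"
    fix x y assume xy: "x \<in> pverts H" "y \<in> pverts H"
    then have "?\<psi> x \<in> pverts G" "?\<psi> y \<in> pverts G"
      using bij_betw_the_inv_into[OF \<phi>(1)] by (auto dest: bij_betwE)
    moreover have "\<phi> (?\<psi> x) = x" "\<phi> (?\<psi> y) = y"
      using xy by (auto intro: f_the_inv_into_f_bij_betw[OF \<phi>(1)])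
    ultimately show "(?\<psi> x, ?\<psi> y) \<in> parcs G \<longleftrightarrow> (x, y) \<in> parcs H"
      using \<phi>(2)[of "?\<psi> x" "?\<psi> y"] by simp
  qed
qed

lemma pair_wf_digraph_graph_complement: "pair_wf_digraph (graph_complement G)"
  by unfold_locales (auto simp: graph_complement_def)

text \<open>
  The vertex \<open>(i, j)\<close> of the disjoint union corresponds to the \<open>j\<close>-th entry of the \<open>i\<close>-th list.
\<close>

lemma (in pair_graph) iso_complement_of_cycles:
  assumes pss: "distinct (concat pss)" "set (concat pss) = pverts G"
    and cyc: "\<forall>ps \<in> set pss. cyclic_listing (non_neighbors G) ps"
  shows "graph_iso G (graph_complement (disjoint_union (map cycle_graph (map length pss))))"
proof -
  define H where "H = graph_complement (disjoint_union (map cycle_graph (map length pss)))"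
  have vH: "pverts H = {(i, j). i < length pss \<and> j < length (pss ! i)}"
    by (auto simp: H_def graph_complement_def disjoint_union_def cycle_graph_def)
  let ?\<phi> = "\<lambda>(i, j). pss ! i ! j"
  have ne: "[] \<notin> set pss" using cyc by (auto simp: cyclic_listing_def)
  then have dp: "distinct pss" using pss(1)
    by (simp add: distinct_concat_iff removeAll_id)
  have disj: "i = i'" if "i < length pss" "i' < length pss" "v \<in> set (pss ! i)" "v \<in> set (pss ! i')"
    for i i' v
  proof -
    have "pss ! i = pss ! i'"
      using that pss(1) by (meson disjoint_iff distinct_concat_iff nth_mem)
    then show ?thesis using dp that by (simp add: nth_eq_iff_index_eq)
  qed
  have eq: "pss ! i ! j = pss ! i' ! j' \<longleftrightarrow> i = i' \<and> j = j'"
    if "(i, j) \<in> pverts H" "(i', j') \<in> pverts H" for i j i' j'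
  proof
    assume *: "pss ! i ! j = pss ! i' ! j'"
    then have "i = i'" using that disj unfolding vH
      by (metis (mono_tags, lifting) case_prodD mem_Collect_eq nth_mem)
    moreover have "distinct (pss ! i)"
      using that(1) cyc unfolding vH by (simp add: cyclic_listing_def)
    ultimately show "i = i' \<and> j = j'"
      using * that by (auto simp: vH nth_eq_iff_index_eq)
  qed simp
  have bij: "bij_betw ?\<phi> (pverts H) (pverts G)"
    unfolding bij_betw_def
  proof
    show "inj_on ?\<phi> (pverts H)" using eq by (auto simp: inj_on_def)
    show "?\<phi> ` pverts H = pverts G"
      by (force simp: pss(2)[symmetric] vH in_set_conv_nth)
  qed
  have wf: "pair_wf_digraph H" by (simp only: H_def pair_wf_digraph_graph_complement)
  have "graph_iso H G"
  proof (rule graph_isoI[OF wf bij pair_wf_digraph_axioms])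
    fix p q assume p: "p \<in> pverts H" and q: "q \<in> pverts H"
    obtain i j i' j' where ij: "p = (i, j)" "q = (i', j')" by fastforce
    let ?l = "length (pss ! i)"
    have lt: "i < length pss" "j < ?l" "i' < length pss" "j' < length (pss ! i')"
      using p q by (auto simp: ij vH)
    have mem: "pss ! i ! j \<in> pverts G" "pss ! i' ! j' \<in> pverts G"
      using lt by (auto simp: pss(2)[symmetric] intro: nth_mem intro!: bexI[OF _ nth_mem])
    have "pss ! i' ! j' \<in> non_neighbors G (pss ! i ! j)
        \<longleftrightarrow> i' = i \<and> (j' = (j + 1) mod ?l \<or> j = (j' + 1) mod ?l)"
      (is "?L \<longleftrightarrow> ?R")
    proof -
      have N: "non_neighbors G (pss ! i ! j) =
          {pss ! i ! m |m. m < ?l \<and> (m = (j + 1) mod ?l \<or> j = (m + 1) mod ?l)}"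
        using cyc lt by (auto simp: cyclic_listing_def)
      show ?thesis
      proof
        assume ?L
        then obtain m where "m < ?l" "m = (j + 1) mod ?l \<or> j = (m + 1) mod ?l"
            "pss ! i' ! j' = pss ! i ! m"
          unfolding N by blast
        with eq[of i' j' i m] lt show ?R by (auto simp: vH)
      next
        assume ?R
        with lt show ?L unfolding N by auto
      qed
    qed
    moreover have "(pss ! i ! j, pss ! i' ! j') \<in> parcs G \<longleftrightarrow>
        pss ! i' ! j' \<noteq> pss ! i ! j \<and> pss ! i' ! j' \<notin> non_neighbors G (pss ! i ! j)"
      using mem pair_no_loops by (force simp: non_neighbors_def neighbors_def)
    moreover have "((i, j), (i', j')) \<in> parcs H \<longleftrightarrow> (i', j') \<noteq> (i, j) \<and>
        \<not> (i' = i \<and> (j' = (j + 1) mod ?l \<or> j = (j' + 1) mod ?l))"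
      using lt by (auto simp: H_def graph_complement_def disjoint_union_def cycle_graph_def)
    ultimately show "(?\<phi> p, ?\<phi> q) \<in> parcs G \<longleftrightarrow> (p, q) \<in> parcs H"
      using eq[of i' j' i j] p q by (auto simp: ij)
  qed
  then have "graph_iso G H"
    by (rule graph_iso_sym[OF wf pair_wf_digraph_axioms])
  then show ?thesis by (simp only: H_def)
qed

text \<open>
  Any two distinct residues modulo 3 are adjacent in the triangle, so nonadjacency in the
  complement is membership in the same part, and the two graphs coincide.
\<close>

lemma complement_of_triangles:
  "graph_complement (disjoint_union (replicate p (cycle_graph 3))) = complete_multipartite p 3"
proof -
  have C3: "(x, y) \<in> parcs (cycle_graph 3) \<longleftrightarrow> x < 3 \<and> y < 3 \<and> x \<noteq> y" for x y
  proof -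
    have "x < 3 \<Longrightarrow> x = 0 \<or> x = 1 \<or> x = 2" "y < 3 \<Longrightarrow> y = 0 \<or> y = 1 \<or> y = 2" by linarith+
    then show ?thesis by (auto simp: cycle_graph_def)
  qed
  have "pverts (cycle_graph 3) = {..<3}" by (simp add: cycle_graph_def)
  with C3 show ?thesis
    by (auto simp: graph_complement_def disjoint_union_def complete_multipartite_def)
qed

section \<open>Integral representations\<close>

text \<open>
  The coordinates of the vectors may be indexed by any finite set.
\<close>

lemma s_integrableI:
  fixes g :: "'a \<Rightarrow> 'i \<Rightarrow> int"
  assumes "0 < s" "finite I"
    and "\<And>x y. x \<in> pverts G \<Longrightarrow> y \<in> pverts G \<Longrightarrow>
      (\<Sum>i\<in>I. g x i * g y i) =
        (if x = y then int s * \<lceil>- smallest_eigenvalue G\<rceil>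
         else if (x, y) \<in> parcs G then int s else 0)"
  shows "s_integrable s G"
proof -
  obtain h where h: "bij_betw h {0..<card I} I"
    using ex_bij_betw_nat_finite[OF assms(2)] by blast
  define f where "f x = vec (card I) (\<lambda>j. g x (h j))" for x
  have "f x \<bullet> f y = (\<Sum>i\<in>I. g x i * g y i)" for x y
  proof -
    have "f x \<bullet> f y = (\<Sum>j\<in>{0..<card I}. g x (h j) * g y (h j))"
      by (simp add: scalar_prod_def f_def)
    also have "\<dots> = (\<Sum>i\<in>I. g x i * g y i)"
      by (rule sum.reindex_bij_betw[OF h])
    finally show ?thesis .
  qed
  moreover have "f x \<in> carrier_vec (card I)" for x by (simp add: f_def)
  ultimately show ?thesis
    using assms(1,3) unfolding s_integrable_def
    by (intro conjI exI[of _ "card I"] exI[of _ f]) auto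
qed

text \<open>
  The characteristic vectors of the sets of edges at a vertex have Gram matrix \<open>k I + A\<close>. This
  represents the 3-cube, where \<open>k = 3\<close> and the smallest eigenvalue is \<open>-3\<close>.
\<close>

lemma (in regular_graph) integrable_incidence:
  assumes "\<lceil>- smallest_eigenvalue G\<rceil> = int k"
  shows "s_integrable 1 G"
proof -
  define E where "E = (\<lambda>(a, b). {a, b}) ` parcs G"
  define g where "g x e = (if x \<in> e then 1 else 0 :: int)" for x :: 'a and e
  have fin: "finite E" using pair_finite_arcs by (simp add: E_def)
  have E_iff: "{a, b} \<in> E \<longleftrightarrow> b \<in> neighbors G a" for a b
    using neighbors_sym by (auto simp: E_def neighbors_def doubleton_eq_iff)
  have E_cases: "\<exists>a b. e = {a, b} \<and> b \<in> neighbors G a" if "e \<in> E" for e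
    using that by (auto simp: E_def neighbors_def)
  have card_eq: "(\<Sum>e\<in>E. g x e * g y e) = int (card {e \<in> E. x \<in> e \<and> y \<in> e})" for x y
  proof -
    have "(\<Sum>e\<in>E. g x e * g y e) = (\<Sum>e\<in>E. if x \<in> e \<and> y \<in> e then 1 else 0)"
      by (intro sum.cong) (auto simp: g_def)
    also have "\<dots> = int (card {e \<in> E. x \<in> e \<and> y \<in> e})"
      using fin by (simp add: sum.If_cases Int_def)
    finally show ?thesis .
  qed
  show ?thesis
  proof (rule s_integrableI[OF _ fin])
    fix x y assume x: "x \<in> pverts G" and y: "y \<in> pverts G"
    consider "x = y" | "x \<noteq> y" "(x, y) \<in> parcs G" | "x \<noteq> y" "(x, y) \<notin> parcs G" by blast
    then show "(\<Sum>e\<in>E. g x e * g y e) =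
        (if x = y then int 1 * \<lceil>- smallest_eigenvalue G\<rceil>
         else if (x, y) \<in> parcs G then int 1 else 0)"
    proof cases
      case 1
      have "{e \<in> E. x \<in> e} = (\<lambda>b. {x, b}) ` neighbors G x"
        using E_cases E_iff neighbors_sym by (force simp: insert_commute)
      moreover have "inj_on (\<lambda>b. {x, b}) (neighbors G x)"
        by (auto simp: inj_on_def doubleton_eq_iff)
      ultimately have "card {e \<in> E. x \<in> e} = k"
        using regular[OF x] by (simp add: card_image)
      then show ?thesis using 1 card_eq[of x y] assms by simp
    next
      case 2
      then have "{e \<in> E. x \<in> e \<and> y \<in> e} = {{x, y}}"
        using E_cases E_iff by (force simp: neighbors_def insert_commute)
      then show ?thesis using 2 card_eq[of x y] by simp
    next
      case 3
      have "{e \<in> E. x \<in> e \<and> y \<in> e} = {}"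
      proof (intro equals0I)
        fix e assume e: "e \<in> {e \<in> E. x \<in> e \<and> y \<in> e}"
        then obtain a b where ab: "e = {a, b}" "b \<in> neighbors G a"
          using E_cases by blast
        with e 3(1) have "a = x \<and> b = y \<or> a = y \<and> b = x" by auto
        with ab(2) 3(2) neighbors_sym show False by (auto simp: neighbors_def)
      qed
      then show ?thesis using 3 card_eq[of x y] by (simp only: card.empty) simp
    qed
  qed simp
qed

text \<open>
  Let \<open>C\<close> be the adjacency matrix of the union of cycles. Then
  \<open>A + 3I = J + (2I - C)\<close>, where \<open>2I - C\<close> is the Laplacian of the cycles and hence the Gram matrix of
  the vectors \<open>e\<^sub>p - e\<^bsub>\<sigma>(p)\<^esub>\<close>, with \<open>\<sigma>\<close> the step to the next vertex of the cycle. One more coordinate, constantly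
  \<open>1\<close>, accounts for the all-ones matrix \<open>J\<close>.
\<close>

lemma integrable_complement_of_cycles:
  fixes G :: "'a pair_pre_digraph"
  assumes wf: "pair_wf_digraph G"
    and iso: "graph_iso G (graph_complement (disjoint_union (map cycle_graph ls)))"
    and ls: "\<And>l. l \<in> set ls \<Longrightarrow> 3 \<le> l"
    and ceil: "\<lceil>- smallest_eigenvalue G\<rceil> = 3"
  shows "s_integrable 1 G"
proof -
  define H where "H = graph_complement (disjoint_union (map cycle_graph ls))"
  obtain \<phi> where bij: "bij_betw \<phi> (pverts G) (pverts H)" and
    \<phi>: "\<And>x y. x \<in> pverts G \<Longrightarrow> y \<in> pverts G \<Longrightarrow> (\<phi> x, \<phi> y) \<in> parcs H \<longleftrightarrow> (x, y) \<in> parcs G"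
    using graph_isoE[OF iso wf] unfolding H_def by blast
  define \<sigma> where "\<sigma> p = (fst p, (snd p + 1) mod (ls ! fst p))" for p :: "nat \<times> nat"
  let ?W = "pverts H"
  have W: "p \<in> ?W \<longleftrightarrow> fst p < length ls \<and> snd p < ls ! fst p" for p
    by (auto simp: H_def graph_complement_def disjoint_union_def cycle_graph_def)
  have "?W = (SIGMA i:{..<length ls}. {..<ls ! i})" using W by auto
  then have fin: "finite ?W" by simp
  have nxt: "(j + 1) mod l = (if j = l - 1 then 0 else j + 1)" if "j < l" for j l :: nat
    using that by auto
  have len: "3 \<le> ls ! i" if "i < length ls" for i using ls that by simp
  have \<sigma>_W: "\<sigma> p \<in> ?W" if "p \<in> ?W" for p using that by (auto simp: W \<sigma>_def)
  have \<sigma>_fix: "\<sigma> p \<noteq> p" if "p \<in> ?W" for p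
    using that len[of "fst p"] nxt[of "snd p" "ls ! fst p"]
    by (auto simp: W \<sigma>_def prod_eq_iff)
  have \<sigma>_2: "\<sigma> (\<sigma> p) \<noteq> p" if "p \<in> ?W" for p
    using that len[of "fst p"] nxt[of "snd p" "ls ! fst p"]
      nxt[of "(snd p + 1) mod (ls ! fst p)" "ls ! fst p"]
    by (auto simp: W \<sigma>_def prod_eq_iff split: if_splits)
  have \<sigma>_inj: "\<sigma> p = \<sigma> q \<longleftrightarrow> p = q" if "p \<in> ?W" "q \<in> ?W" for p q
    using that nxt[of "snd p" "ls ! fst p"] nxt[of "snd q" "ls ! fst q"]
    by (auto simp: W \<sigma>_def prod_eq_iff split: if_splits)
  have arc: "(p, q) \<in> parcs H \<longleftrightarrow> p \<noteq> q \<and> q \<noteq> \<sigma> p \<and> p \<noteq> \<sigma> q" if "p \<in> ?W" "q \<in> ?W" for p q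
    using that
    by (auto simp: W \<sigma>_def H_def graph_complement_def disjoint_union_def cycle_graph_def
        prod_eq_iff split: prod.splits)
  \<comment> \<open>The coordinate \<open>None\<close> is the constant one.\<close>
  define \<delta> where "\<delta> a b = (if a = b then 1 else 0 :: int)" for a b :: "nat \<times> nat"
  define g where "g x = case_option 1 (\<lambda>r. \<delta> r (\<phi> x) - \<delta> r (\<sigma> (\<phi> x)))" for x
  have \<delta>_commute: "\<delta> a b = \<delta> b a" for a b by (simp add: \<delta>_def)
  have \<delta>_sum: "(\<Sum>r\<in>?W. \<delta> r a * \<delta> r b) = \<delta> a b" if "a \<in> ?W" for a b
  proof -
    have "(\<Sum>r\<in>?W. \<delta> r a * \<delta> r b) = (\<Sum>r\<in>?W. if r = a then \<delta> a b else 0)"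
      by (intro sum.cong) (auto simp: \<delta>_def)
    then show ?thesis using that fin by simp
  qed
  show ?thesis
  proof (rule s_integrableI)
    show "finite (insert None (Some ` ?W))" using fin by simp
    fix x y assume x: "x \<in> pverts G" and y: "y \<in> pverts G"
    let ?p = "\<phi> x" and ?q = "\<phi> y"
    have p: "?p \<in> ?W" "?q \<in> ?W" using x y bij by (auto dest: bij_betwE)
    have eq: "?p = ?q \<longleftrightarrow> x = y" using x y bij by (auto simp: bij_betw_def dest: inj_onD)
    have "(\<Sum>i\<in>insert None (Some ` ?W). g x i * g y i) =
        1 + (\<Sum>r\<in>?W. (\<delta> r ?p - \<delta> r (\<sigma> ?p)) * (\<delta> r ?q - \<delta> r (\<sigma> ?q)))"
      using fin by (simp add: g_def sum.reindex)
    also have "\<dots> = 1 + (\<delta> ?p ?q - \<delta> ?p (\<sigma> ?q) - \<delta> (\<sigma> ?p) ?q + \<delta> (\<sigma> ?p) (\<sigma> ?q))"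
      using \<delta>_sum p \<sigma>_W \<delta>_commute[of ?q "\<sigma> ?p"]
      by (simp add: algebra_simps sum.distrib sum_subtractf)
    also have "\<dots> = (if x = y then int 1 * \<lceil>- smallest_eigenvalue G\<rceil>
         else if (x, y) \<in> parcs G then int 1 else 0)"
    proof -
      define A B where "A \<longleftrightarrow> ?p = \<sigma> ?q" and "B \<longleftrightarrow> ?q = \<sigma> ?p"
      have "\<not> (A \<and> B)" using \<sigma>_2[OF p(1)] unfolding A_def B_def by metis
      moreover have "x = y \<Longrightarrow> \<not> A \<and> \<not> B" using \<sigma>_fix[OF p(1)] unfolding A_def B_def by metis
      moreover have "(x, y) \<in> parcs G \<longleftrightarrow> x \<noteq> y \<and> \<not> A \<and> \<not> B"
        using arc[OF p] \<phi>[OF x y] eq unfolding A_def B_def by blast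
      moreover have "\<delta> ?p ?q = of_bool (x = y)" "\<delta> (\<sigma> ?p) (\<sigma> ?q) = of_bool (x = y)"
        by (simp_all add: \<delta>_def eq \<sigma>_inj[OF p])
      moreover have "\<delta> ?p (\<sigma> ?q) = of_bool A" "\<delta> (\<sigma> ?p) ?q = of_bool B"
        unfolding \<delta>_def A_def B_def by (simp_all only: of_bool_def eq_commute)
      ultimately show ?thesis using ceil by auto
    qed
    finally show "(\<Sum>i\<in>insert None (Some ` ?W). g x i * g y i) =
        (if x = y then int 1 * \<lceil>- smallest_eigenvalue G\<rceil>
         else if (x, y) \<in> parcs G then int 1 else 0)" .
  qed simp
qed

section \<open>Regular and sesqui-regular graphs\<close>

context regular_graph
begin

lemma card_eq_valency:
  "x \<in> pverts G \<Longrightarrow> card (pverts G) = k + card (non_neighbors G x) + 1"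
  using card_non_neighbors regular by simp

lemma complement_two_regular:
  assumes "card (pverts G) = k + 3"
  shows "two_regular_relation (pverts G) (non_neighbors G)"
proof
  show "finite (pverts G)" by (rule pair_finite_verts)
  fix x assume x: "x \<in> pverts G"
  show "non_neighbors G x \<subseteq> pverts G" "x \<notin> non_neighbors G x"
    by (auto simp: non_neighbors_def)
  show "card (non_neighbors G x) = 2" using card_eq_valency[OF x] assms by simp
  show "x \<in> non_neighbors G y" if "y \<in> non_neighbors G x" for y
    using non_neighbors_sym x that by blast
qed

lemma valency_ge_3:
  assumes "smallest_eigenvalue G < -2"
  shows "3 \<le> k"
proof -
  obtain u where "eigenfunction G (smallest_eigenvalue G) u"
    by (rule smallest_eigenvalue_eigenfunction)
  from abs_eigenvalue_le_valency[OF this] assms show ?thesis by linarith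
qed

end

locale sesqui_regular_graph = regular_graph G k for G :: "'a pair_pre_digraph" and k +
  fixes c :: nat
  assumes conn: "Digraph_Component.connected (with_proj G)"
    and common: "x \<in> pverts G \<Longrightarrow> y \<in> pverts G \<Longrightarrow> graph_distance G x y = 2
      \<Longrightarrow> card (common_neighbors G x y) = c"
begin

lemma card_common_neighbors:
  assumes "x \<noteq> y" "y \<notin> neighbors G x" "z \<in> neighbors G x" "z \<in> neighbors G y"
  shows "card (neighbors G x \<inter> neighbors G y) = c"
proof -
  have "x \<in> pverts G" "y \<in> pverts G"
    using assms(3,4) neighbors_subset neighbors_sym by blast+
  then show ?thesis
    using common graph_distance_eq_2[OF assms] by (simp add: common_neighbors_eq)
qed

section \<open>The case \<open>c = k\<close>\<close>

text \<open>
  Two vertices at distance two share all \<open>k\<close> neighbours. Hence \<open>N(x)\<close> together with all vertices \<open>b\<close>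
  such that \<open>N(b) = N(x)\<close> is closed under adjacency, and it is the whole graph.
\<close>

lemma neighbors_eq:
  assumes c: "c = k" and x: "x \<in> pverts G" and y: "y \<in> non_neighbors G x"
  shows "neighbors G y = neighbors G x"
proof -
  have twin: "neighbors G b = neighbors G a"
    if "a \<noteq> b" "b \<notin> neighbors G a" "z \<in> neighbors G a" "z \<in> neighbors G b" for a b z
  proof -
    have V: "a \<in> pverts G" "b \<in> pverts G"
      using that(3,4) neighbors_subset neighbors_sym by blast+
    then have "card (neighbors G a \<inter> neighbors G b) = card (neighbors G a)"
        "card (neighbors G a \<inter> neighbors G b) = card (neighbors G b)"
      using card_common_neighbors[OF that] c regular by simp_all
    then have "neighbors G a \<inter> neighbors G b = neighbors G a"
        "neighbors G a \<inter> neighbors G b = neighbors G b"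
      by (intro card_subset_eq; simp)+
    then show ?thesis by blast
  qed
  let ?S = "neighbors G x \<union> {b \<in> pverts G. neighbors G b = neighbors G x}"
  have "?S = pverts G"
  proof (rule connected_closed_set[OF conn])
    fix a assume a: "a \<in> ?S"
    show "neighbors G a \<subseteq> ?S"
    proof (cases "a \<in> neighbors G x")
      case True
      have "b \<in> ?S" if b: "b \<in> neighbors G a" for b
      proof (cases "b = x \<or> b \<in> neighbors G x")
        case True
        with x show ?thesis by auto
      next
        case False
        then have "neighbors G b = neighbors G x"
          using twin[of x b a] \<open>a \<in> neighbors G x\<close> b neighbors_sym by metis
        then show ?thesis using b neighbors_subset by blast
      qed
      then show ?thesis by blast
    next
      case False
      with a show ?thesis by blast
    qed
  qed (use x neighbors_subset in auto)
  then show ?thesis using y by (auto simp: non_neighbors_def)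
qed

text \<open>
  The graph is multipartite, so its smallest eigenvalue is the integer \<open>k - n\<close>, and this must be
  \<open>-3\<close>. Each vertex then has two non-neighbours, and nonadjacency is transitive, which leaves only
  triangles in the cycle decomposition of the complement.
\<close>

lemma complement_of_triangles_iso:
  assumes c: "c = k" and lam: "- 3 \<le> smallest_eigenvalue G" "smallest_eigenvalue G < - 2"
  shows "\<exists>p. card (pverts G) = 3 * p \<and> 2 \<le> p \<and>
    graph_iso G (graph_complement (disjoint_union (replicate p (cycle_graph 3))))"
proof -
  have "smallest_eigenvalue G = real k - real (card (pverts G))"
    by (rule multipartite_smallest_eigenvalue) (use neighbors_eq[OF c] lam in auto)
  then have n: "card (pverts G) = k + 3" using lam by linarith
  obtain pss where pss: "distinct (concat pss)" "set (concat pss) = pverts G"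
      and cyc: "\<forall>ps \<in> set pss. cyclic_listing (non_neighbors G) ps"
    using cycle_decomposition[OF complement_two_regular[OF n]] by blast
  have len: "length ps = 3" if ps: "ps \<in> set pss" for ps
  proof -
    let ?l = "length ps"
    have d: "distinct ps" and l: "3 \<le> ?l"
      using cyc ps by (auto simp: cyclic_listing_def)
    have mem: "ps ! j \<in> non_neighbors G (ps ! i) \<longleftrightarrow> j = (i + 1) mod ?l \<or> i = (j + 1) mod ?l"
      if "i < ?l" "j < ?l" for i j
      using cyclic_listing_mem_iff cyc ps that by blast
    have "ps \<noteq> []" using l by auto
    have V: "ps ! i \<in> pverts G" if "i < ?l" for i
      using ps nth_mem[OF that] unfolding pss(2)[symmetric] set_concat by blast
    have V01: "ps ! 0 \<in> pverts G" "ps ! 1 \<in> pverts G"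
      using V[of 0] V[of 1] l \<open>ps \<noteq> []\<close> by simp_all
    have adj: "ps ! 1 \<in> non_neighbors G (ps ! 0)" "ps ! 2 \<in> non_neighbors G (ps ! 1)"
      using mem[of 0 1] mem[of 1 2] l \<open>ps \<noteq> []\<close> by simp_all
    have eq: "neighbors G (ps ! 2) = neighbors G (ps ! 0)"
      using neighbors_eq[OF c V01(1) adj(1)] neighbors_eq[OF c V01(2) adj(2)] by simp
    have "ps ! 2 \<noteq> ps ! 0" using d l \<open>ps \<noteq> []\<close> by (simp add: nth_eq_iff_index_eq)
    moreover have "ps ! 2 \<notin> neighbors G (ps ! 2)" by simp
    ultimately have "ps ! 2 \<in> non_neighbors G (ps ! 0)"
      using V[of 2] l neighbors_sym[of "ps ! 2" "ps ! 0"]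
      unfolding non_neighbors_def eq[symmetric] by simp
    then have "0 = 3 mod ?l" using mem[of 0 2] l \<open>ps \<noteq> []\<close> by simp
    then have "?l dvd 3" by auto
    then show ?thesis using l by (auto dest: dvd_imp_le)
  qed
  let ?p = "length pss"
  have map: "map cycle_graph (map length pss) = replicate ?p (cycle_graph 3)"
    using len by (induction pss) auto
  have "card (pverts G) = length (concat pss)"
    using pss distinct_card by metis
  also have "\<dots> = 3 * ?p"
    using len by (induction pss) auto
  finally have card: "card (pverts G) = 3 * ?p" .
  moreover have "2 \<le> ?p" using card n valency_ge_3[OF lam(2)] by simp
  ultimately show ?thesis
    using iso_complement_of_cycles[OF pss cyc] unfolding map by blast
qed

section \<open>The case \<open>c = k - 1\<close>: diameter three\<close>

text \<open>
  A path of length three between \<open>x\<close> and \<open>z\<close>, which have no common neighbour, determines the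
  graph. If \<open>a \<in> N(x)\<close> has a neighbour in \<open>N(z)\<close>, then \<open>a\<close> and \<open>z\<close> are at distance two, so \<open>a\<close> is adjacent to
  \<open>x\<close>, to all but one vertex of \<open>N(z)\<close>, and to nothing else. Any other \<open>a' \<in> N(x)\<close> shares \<open>k - 1 \<ge> 2\<close> neighbours with \<open>a\<close>,
  one of them in \<open>N(z)\<close>, so the same holds for \<open>a'\<close>. The graph is therefore bipartite; its smallest eigenvalue
  is at most \<open>-k\<close>, which forces \<open>k = 3\<close>.
\<close>

lemma antipodal:
  assumes c: "c + 1 = k" and lam: "- 3 \<le> smallest_eigenvalue G" "smallest_eigenvalue G < - 2"
    and path: "a \<in> neighbors G x" "b \<in> neighbors G a" "z \<in> neighbors G b"
    and far: "x \<noteq> z" "z \<notin> neighbors G x" "neighbors G x \<inter> neighbors G z = {}"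
  shows "k = 3 \<and> pverts G = {x, z} \<union> neighbors G x \<union> neighbors G z \<and>
    (\<forall>a \<in> neighbors G x. neighbors G a \<subseteq> insert x (neighbors G z) \<and> card (neighbors G a \<inter> neighbors G z) = 2) \<and>
    (\<forall>b \<in> neighbors G z. neighbors G b \<subseteq> insert z (neighbors G x) \<and> card (neighbors G b \<inter> neighbors G x) = 2)"
proof -
  have k3: "3 \<le> k" by (rule valency_ge_3[OF lam(2)])
  \<comment> \<open>Stated for both orientations of the path, so that it applies from either end.\<close>
  have one: "neighbors G a \<subseteq> insert x (neighbors G z) \<and>
      card (neighbors G a \<inter> neighbors G z) = k - 1"
    if "x \<noteq> z" "z \<notin> neighbors G x" "neighbors G x \<inter> neighbors G z = {}"
      "a \<in> neighbors G x" "b \<in> neighbors G a" "b \<in> neighbors G z" for x z a b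
  proof -
    have "a \<noteq> z" "z \<notin> neighbors G a" using that neighbors_sym by blast+
    then have card: "card (neighbors G a \<inter> neighbors G z) = k - 1"
      using card_common_neighbors[of a z b] that c by auto
    have "x \<notin> neighbors G z" using that neighbors_sym by blast
    then have "card (insert x (neighbors G a \<inter> neighbors G z)) = k"
      using card k3 by simp
    moreover have "card (neighbors G a) = k"
      using regular that(4) neighbors_subset by blast
    moreover have "insert x (neighbors G a \<inter> neighbors G z) \<subseteq> neighbors G a"
      using that(4) neighbors_sym by blast
    ultimately have "insert x (neighbors G a \<inter> neighbors G z) = neighbors G a"
      by (intro card_subset_eq) auto
    then have "neighbors G a \<subseteq> insert x (neighbors G z)" by blast
    with card show ?thesis by simp
  qed
  have all: "neighbors G a' \<subseteq> insert x (neighbors G z) \<and>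
      card (neighbors G a' \<inter> neighbors G z) = k - 1"
    if far: "x \<noteq> z" "z \<notin> neighbors G x" "neighbors G x \<inter> neighbors G z = {}"
      and path: "a \<in> neighbors G x" "b \<in> neighbors G a" "b \<in> neighbors G z"
      and a': "a' \<in> neighbors G x" for x z a b a'
  proof (cases "a' = a")
    case True
    with one[OF far path] show ?thesis by simp
  next
    case False
    have Na: "neighbors G a \<subseteq> insert x (neighbors G z)"
      using one[OF far path] by blast
    have "a' \<noteq> x" using a' by auto
    then have "a' \<notin> neighbors G a" using Na a' far(3) by blast
    moreover have "x \<in> neighbors G a" "x \<in> neighbors G a'"
      using path(1) a' neighbors_sym by blast+
    ultimately have "card (neighbors G a \<inter> neighbors G a') = k - 1"
      using card_common_neighbors[of a a' x] False c by auto
    then have "\<not> neighbors G a \<inter> neighbors G a' \<subseteq> {x}"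
      using k3 card_mono[of "{x}" "neighbors G a \<inter> neighbors G a'"] by auto
    then obtain b' where "b' \<in> neighbors G a'" "b' \<in> neighbors G z"
      using Na by blast
    with one[OF far a'] show ?thesis by blast
  qed
  have zb: "b \<in> neighbors G z" and ab: "a \<in> neighbors G b"
    using path neighbors_sym by blast+
  have far': "z \<noteq> x" "x \<notin> neighbors G z" "neighbors G z \<inter> neighbors G x = {}"
    using far neighbors_sym by blast+
  have A: "neighbors G a' \<subseteq> insert x (neighbors G z)"
      "card (neighbors G a' \<inter> neighbors G z) = k - 1" if "a' \<in> neighbors G x" for a'
    using all[OF far path(1,2) zb that] by blast+
  have B: "neighbors G b' \<subseteq> insert z (neighbors G x)"
      "card (neighbors G b' \<inter> neighbors G x) = k - 1" if "b' \<in> neighbors G z" for b'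
    using all[OF far' zb ab path(1) that] by blast+
  have x: "x \<in> pverts G" and z: "z \<in> pverts G"
    using path neighbors_subset neighbors_sym by blast+
  have V: "{x, z} \<union> neighbors G x \<union> neighbors G z = pverts G"
  proof (rule connected_closed_set[OF conn])
    fix v assume "v \<in> {x, z} \<union> neighbors G x \<union> neighbors G z"
    then show "neighbors G v \<subseteq> {x, z} \<union> neighbors G x \<union> neighbors G z"
      using A(1) B(1) by blast
  qed (use x z neighbors_subset in auto)
  \<comment> \<open>The graph is bipartite with colour classes \<open>{x} \<union> N(z)\<close> and \<open>{z} \<union> N(x)\<close>, so
    changing the sign of the all-ones eigenvector on one class gives the eigenvalue \<open>-k\<close>.\<close>
  define u where "u v = (if v = x \<or> v \<in> neighbors G z then 1 else - 1 :: real)" for v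
  have "(\<Sum>w \<in> neighbors G v. u w) = - real k * u v" if v: "v \<in> pverts G" for v
  proof -
    have "u w = - u v" if w: "w \<in> neighbors G v" for w
    proof -
      consider "v = x" | "v = z" | "v \<in> neighbors G x" | "v \<in> neighbors G z"
        using v V by blast
      then show ?thesis
      proof cases
        case 1
        then have "w \<noteq> x" "w \<notin> neighbors G z" using w far(3) by auto
        then show ?thesis using 1 by (simp add: u_def)
      next
        case 2
        then have "u w = 1" using w by (simp add: u_def)
        moreover have "u v = - 1" using 2 far(1) by (simp add: u_def)
        ultimately show ?thesis by simp
      next
        case 3
        then have "u w = 1" using w A(1) by (auto simp: u_def)
        moreover have "v \<noteq> x" "v \<notin> neighbors G z" using 3 far(3) by auto
        ultimately show ?thesis by (simp add: u_def)
      next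
        case 4
        then have "w \<in> insert z (neighbors G x)" using w B(1) by blast
        then have "w \<noteq> x" "w \<notin> neighbors G z" using far by auto
        then show ?thesis using 4 by (simp add: u_def)
      qed
    qed
    then have "(\<Sum>w \<in> neighbors G v. u w) = (\<Sum>w \<in> neighbors G v. - u v)"
      by (rule sum.cong[OF refl])
    then show ?thesis using regular[OF v] by simp
  qed
  moreover have "u x \<noteq> 0" by (simp add: u_def)
  ultimately have "eigenfunction G (- real k) u"
    using x by (auto simp: eigenfunction_def)
  from smallest_eigenvalue_le[OF this] have "k = 3" using lam k3 by linarith
  then show ?thesis using V A B by auto
qed

end

lemma hypercube_3_arc:
  "([a, b, c], [d, e, f]) \<in> parcs (hypercube 3) \<longleftrightarrow>
    of_bool (a \<noteq> d) + of_bool (b \<noteq> e) + of_bool (c \<noteq> f) = (1 :: nat)"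
proof -
  have "{i. i < 3 \<and> [a, b, c] ! i \<noteq> [d, e, f] ! i} =
      (if a \<noteq> d then {0} else {}) \<union> (if b \<noteq> e then {1} else {}) \<union> (if c \<noteq> f then {2} else {})"
    by (auto simp: less_Suc_eq numeral_3_eq_3 numeral_2_eq_2)
  then show ?thesis by (simp add: hypercube_def)
qed

lemma length_3_iff: "length p = 3 \<longleftrightarrow> (\<exists>a b c. p = [a, b, c])"
  by (auto simp: numeral_3_eq_3 length_Suc_conv)

lemma neighbors_hypercube_3:
  "neighbors (hypercube 3) [a, b, c] = {[\<not> a, b, c], [a, \<not> b, c], [a, b, \<not> c]}"
proof -
  have arc: "([a, b, c], [d, e, f]) \<in> parcs (hypercube 3) \<longleftrightarrow>
      [d, e, f] \<in> {[\<not> a, b, c], [a, \<not> b, c], [a, b, \<not> c]}" for d e f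
    unfolding hypercube_3_arc by (cases "a = d"; cases "b = e"; cases "c = f") auto
  have len: "length q = 3" if "(p, q) \<in> parcs (hypercube 3)" for p q
    using that by (simp add: hypercube_def)
  have "q \<in> neighbors (hypercube 3) [a, b, c] \<longleftrightarrow>
      q \<in> {[\<not> a, b, c], [a, \<not> b, c], [a, b, \<not> c]}" for q
  proof (cases "length q = 3")
    case True
    then obtain d e f where "q = [d, e, f]" by (auto simp: length_3_iff)
    then show ?thesis by (simp only: neighbors_def mem_Collect_eq arc)
  next
    case False
    then have "q \<notin> neighbors (hypercube 3) [a, b, c]" using len by (auto simp: neighbors_def)
    then show ?thesis using False by auto
  qed
  then show ?thesis by blast
qed

lemma pair_wf_digraph_hypercube: "pair_wf_digraph (hypercube d)"
  by unfold_locales (auto simp: hypercube_def)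

lemma (in pair_graph) iso_hypercube_3:
  assumes V: "pverts G = {x, a0, a1, a2, b0, b1, b2, z}" "distinct [x, a0, a1, a2, b0, b1, b2, z]"
    and N: "neighbors G x = {a0, a1, a2}" "neighbors G z = {b0, b1, b2}"
      "neighbors G a0 = {x, b1, b2}" "neighbors G a1 = {x, b0, b2}" "neighbors G a2 = {x, b0, b1}"
      "neighbors G b0 = {z, a1, a2}" "neighbors G b1 = {z, a0, a2}" "neighbors G b2 = {z, a0, a1}"
  shows "graph_iso G (hypercube 3)"
proof -
  define h where "h u = (if u = [False, False, False] then x else if u = [True, False, False] then a0
    else if u = [False, True, False] then a1 else if u = [False, False, True] then a2
    else if u = [False, True, True] then b0 else if u = [True, False, True] then b1
    else if u = [True, True, False] then b2 else z)" for u
  have h: "h [False, False, False] = x" "h [True, False, False] = a0" "h [False, True, False] = a1"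
    "h [False, False, True] = a2" "h [False, True, True] = b0" "h [True, False, True] = b1"
    "h [True, True, False] = b2" "h [True, True, True] = z"
    by (simp_all add: h_def)
  have W: "pverts (hypercube 3) = {p. length p = 3}" by (simp add: hypercube_def)
  have cardW: "card {p :: bool list. length p = 3} = 8"
    using card_lists_length_eq[of "UNIV :: bool set" 3] by simp
  have "v \<in> h ` {p. length p = 3}" if "v \<in> pverts G" for v
  proof -
    have "v \<in> h ` {[False, False, False], [True, False, False], [False, True, False],
        [False, False, True], [False, True, True], [True, False, True], [True, True, False],
        [True, True, True]}"
      using that unfolding V(1) by (simp only: image_insert h image_empty)
    then show ?thesis by (rule subsetD[OF image_mono, rotated]) simp
  qed
  moreover have "h p \<in> pverts G" for p unfolding V(1) h_def by simp
  ultimately have im: "h ` pverts (hypercube 3) = pverts G" unfolding W by blast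
  have "pverts G = set [x, a0, a1, a2, b0, b1, b2, z]" using V(1) by simp
  then have "card (pverts G) = 8" using distinct_card[OF V(2)] by simp
  then have inj: "inj_on h (pverts (hypercube 3))"
    using im cardW unfolding W
    by (intro eq_card_imp_inj_on) (simp_all add: card_ge_0_finite)
  have Nh: "neighbors G (h p) = h ` neighbors (hypercube 3) p" if "p \<in> pverts (hypercube 3)" for p
  proof -
    obtain a b c where p: "p = [a, b, c]" using \<open>p \<in> pverts (hypercube 3)\<close>
      unfolding W mem_Collect_eq length_3_iff by blast
    show ?thesis
      unfolding p neighbors_hypercube_3 by (cases a; cases b; cases c) (auto simp: h N)
  qed
  have "graph_iso (hypercube 3) G"
  proof (rule graph_isoI[OF pair_wf_digraph_hypercube _ pair_wf_digraph_axioms])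
    show "bij_betw h (pverts (hypercube 3)) (pverts G)" using im inj by (simp add: bij_betw_def)
    fix p q :: "bool list"
    assume p: "p \<in> pverts (hypercube 3)" and q: "q \<in> pverts (hypercube 3)"
    have "neighbors (hypercube 3) p \<subseteq> pverts (hypercube 3)"
      by (auto simp: neighbors_def hypercube_def)
    then have "h q \<in> neighbors G (h p) \<longleftrightarrow> q \<in> neighbors (hypercube 3) p"
      unfolding Nh[OF p] by (rule inj_on_image_mem_iff[OF inj q])
    then show "(h p, h q) \<in> parcs G \<longleftrightarrow> (p, q) \<in> parcs (hypercube 3)"
      by (simp add: neighbors_def)
  qed
  then show ?thesis
    by (rule graph_iso_sym[OF pair_wf_digraph_hypercube pair_wf_digraph_axioms])
qed

context sesqui_regular_graph
begin

text \<open>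
  Each vertex of \<open>N(x)\<close> misses exactly one vertex of \<open>N(z)\<close>, and this pairing \<open>f\<close> is a bijection. So
  the graph is \<open>K\<^bsub>4,4\<^esub>\<close> minus a perfect matching, which is the cube: \<open>x\<close> and \<open>z\<close> are two opposite
  corners, and the vertices of \<open>N(x)\<close> are the unit vectors, each opposite to its partner under \<open>f\<close>.
\<close>

lemma antipodal_iso_hypercube:
  assumes c: "c + 1 = k" and lam: "- 3 \<le> smallest_eigenvalue G" "smallest_eigenvalue G < - 2"
    and path: "a \<in> neighbors G x" "b \<in> neighbors G a" "z \<in> neighbors G b"
    and far: "x \<noteq> z" "z \<notin> neighbors G x" "neighbors G x \<inter> neighbors G z = {}"
  shows "k = 3 \<and> graph_iso G (hypercube 3)"
proof -
  let ?A = "neighbors G x" and ?B = "neighbors G z"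
  have k: "k = 3" and V: "pverts G = {x, z} \<union> ?A \<union> ?B"
    and A: "\<And>a. a \<in> ?A \<Longrightarrow> neighbors G a \<subseteq> insert x ?B" "\<And>a. a \<in> ?A \<Longrightarrow> card (neighbors G a \<inter> ?B) = 2"
    and B: "\<And>b. b \<in> ?B \<Longrightarrow> neighbors G b \<subseteq> insert z ?A" "\<And>b. b \<in> ?B \<Longrightarrow> card (neighbors G b \<inter> ?A) = 2"
    using antipodal[OF c lam path far] by blast+
  have deg: "card (neighbors G v) = 3" if "v \<in> pverts G" for v
    using regular[OF that] k by simp
  have xz: "x \<notin> ?B" "z \<notin> ?A" using far(2) neighbors_sym by blast+
  obtain a0 a1 a2 where a: "?A = {a0, a1, a2}" "a0 \<noteq> a1" "a0 \<noteq> a2" "a1 \<noteq> a2"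
    using deg[of x] V by (auto simp: card_3_iff)
  have "\<exists>b. ?B - neighbors G a = {b}" if "a \<in> ?A" for a
  proof -
    have "card (?B - neighbors G a) = card ?B - card (neighbors G a \<inter> ?B)"
      by (simp add: card_Diff_subset_Int Int_commute)
    also have "\<dots> = 1" using A(2)[OF that] deg[of z] V by simp
    finally show ?thesis by (simp add: card_1_singleton_iff)
  qed
  then obtain f where f: "\<And>a. a \<in> ?A \<Longrightarrow> ?B - neighbors G a = {f a}" by metis
  have f_inj: "f p \<noteq> f q" if "p \<in> ?A" "q \<in> ?A" "p \<noteq> q" for p q
  proof
    assume eq: "f p = f q"
    have fp: "f p \<in> ?B" "p \<notin> neighbors G (f p)" "q \<notin> neighbors G (f p)"
      using f[OF that(1)] f[OF that(2)] eq neighbors_sym by blast+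
    then have "neighbors G (f p) \<inter> ?A \<subseteq> ?A - {p, q}" by blast
    then have "card (neighbors G (f p) \<inter> ?A) \<le> card (?A - {p, q})"
      by (intro card_mono) auto
    moreover have "card (?A - {p, q}) = 1"
      using that deg[of x] V by (simp add: card_Diff_subset)
    ultimately show False using B(2)[OF fp(1)] by simp
  qed
  have fA: "f a0 \<in> ?B" "f a1 \<in> ?B" "f a2 \<in> ?B"
    using f[of a0] f[of a1] f[of a2] a(1) by auto
  have fd: "f a0 \<noteq> f a1" "f a0 \<noteq> f a2" "f a1 \<noteq> f a2"
    using f_inj a by auto
  have b: "?B = {f a0, f a1, f a2}"
  proof (rule card_subset_eq[symmetric])
    show "card {f a0, f a1, f a2} = card ?B" using fd deg[of z] V by simp
  qed (use fA in auto)
  have NA: "neighbors G p = insert x (?B - {f p})" if p: "p \<in> ?A" for p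
  proof -
    have "x \<in> neighbors G p" using p neighbors_sym by blast
    moreover have "f p \<notin> neighbors G p" using f[OF p] by blast
    moreover have "?B - {f p} \<subseteq> neighbors G p" using f[OF p] by blast
    ultimately show ?thesis using A(1)[OF p] xz by blast
  qed
  have NB: "neighbors G q = insert z {p \<in> ?A. f p \<noteq> q}" if q: "q \<in> ?B" for q
  proof -
    have "z \<in> neighbors G q" using q neighbors_sym by blast
    moreover have "p \<in> neighbors G q \<longleftrightarrow> f p \<noteq> q" if "p \<in> ?A" for p
    proof -
      have "q \<in> ?B - neighbors G p \<longleftrightarrow> q = f p" by (simp only: f[OF that] singleton_iff)
      then show ?thesis using q neighbors_sym[of p q] by auto
    qed
    ultimately show ?thesis using B(1)[OF q] xz by blast
  qed
  have "graph_iso G (hypercube 3)"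
  proof (rule iso_hypercube_3)
    show "pverts G = {x, a0, a1, a2, f a0, f a1, f a2, z}" using V a(1) b by auto
    show "distinct [x, a0, a1, a2, f a0, f a1, f a2, z]"
    proof -
      have "{a0, a1, a2} \<inter> {f a0, f a1, f a2} = {}" using far(3) unfolding a(1) b .
      moreover have "x \<notin> {a0, a1, a2}" "z \<notin> {f a0, f a1, f a2}"
        using neighbors_irrefl[of x] neighbors_irrefl[of z] unfolding a(1) b .
      moreover have "x \<notin> {f a0, f a1, f a2}" "z \<notin> {a0, a1, a2}"
        using xz unfolding a(1) b .
      ultimately show ?thesis using a(2-4) fd far(1) by (simp add: eq_commute)
    qed
    show "neighbors G x = {a0, a1, a2}" by (rule a(1))
    show "neighbors G z = {f a0, f a1, f a2}" by (rule b)
    have "a0 \<in> ?A" "a1 \<in> ?A" "a2 \<in> ?A" using a(1) by auto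
    then show "neighbors G a0 = {x, f a1, f a2}" "neighbors G a1 = {x, f a0, f a2}"
        "neighbors G a2 = {x, f a0, f a1}"
      unfolding b using NA fd by (auto simp: b)
    show "neighbors G (f a0) = {z, a1, a2}" "neighbors G (f a1) = {z, a0, a2}"
        "neighbors G (f a2) = {z, a0, a1}"
      unfolding NB[OF fA(1)] NB[OF fA(2)] NB[OF fA(3)] a(1) using fd by auto
  qed
  with k show ?thesis by blast
qed

end

section \<open>The case \<open>c = k - 1\<close>: diameter two\<close>

locale diameter_two_graph = sesqui_regular_graph +
  assumes c_eq: "c + 1 = k"
    and diam: "x \<in> pverts G \<Longrightarrow> y \<in> non_neighbors G x \<Longrightarrow> neighbors G x \<inter> neighbors G y \<noteq> {}"
    and lam: "- 3 \<le> smallest_eigenvalue G" "smallest_eigenvalue G < - 2"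
begin

text \<open>
  Of the \<open>k\<close> neighbours of \<open>y\<close> exactly \<open>k - 1\<close> are in \<open>N(x)\<close>. The non-neighbours of \<open>x\<close> therefore carry
  a perfect matching, and \<open>y\<close> misses a single vertex of \<open>N(x)\<close>.
\<close>

lemma matching:
  assumes x: "x \<in> pverts G" and y: "y \<in> non_neighbors G x"
  shows "card (neighbors G y \<inter> non_neighbors G x) = 1"
    and "card (non_neighbors G y \<inter> neighbors G x) = 1"
proof -
  have yV: "y \<in> pverts G" "y \<noteq> x" "y \<notin> neighbors G x"
    using y by (auto simp: non_neighbors_def)
  have xy: "x \<notin> neighbors G y" using yV neighbors_sym by blast
  have k: "3 \<le> k" by (rule valency_ge_3[OF lam(2)])
  obtain z where "z \<in> neighbors G x" "z \<in> neighbors G y" using diam[OF x y] by blast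
  then have card: "card (neighbors G x \<inter> neighbors G y) = k - 1"
    using card_common_neighbors[of x y z] yV c_eq by auto
  have "neighbors G y \<inter> non_neighbors G x = neighbors G y - (neighbors G x \<inter> neighbors G y)"
    using neighbors_subset xy by (auto simp: non_neighbors_def)
  then show "card (neighbors G y \<inter> non_neighbors G x) = 1"
    using card regular[OF yV(1)] k by (simp add: card_Diff_subset)
  have "non_neighbors G y \<inter> neighbors G x = neighbors G x - (neighbors G x \<inter> neighbors G y)"
    using neighbors_subset yV by (auto simp: non_neighbors_def)
  then show "card (non_neighbors G y \<inter> neighbors G x) = 1"
    using card regular[OF x] k by (simp add: card_Diff_subset)
qed

text \<open>
  Write \<open>f y\<close> for the partner of \<open>y\<close> in the matching on the non-neighbours of \<open>x\<close>, and \<open>g y\<close> for the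
  vertex of \<open>N(x)\<close> missed by \<open>y\<close>. The partner of \<open>g y\<close> in the matching on the non-neighbours of \<open>y\<close> is
  \<open>x\<close>, so \<open>g y\<close> is nonadjacent to every other vertex there, in particular to each non-neighbour \<open>z\<close> of \<open>x\<close>
  with \<open>z \<noteq> y, f y\<close>; that is, \<open>g z = g y\<close>. With three or more non-neighbours this makes \<open>g\<close>
  constant, and its value is the twin.
\<close>

lemma ex_twin:
  assumes x: "x \<in> pverts G" and m: "3 \<le> card (non_neighbors G x)"
  shows "\<exists>w \<in> neighbors G x. non_neighbors G w = non_neighbors G x"
proof -
  let ?M = "non_neighbors G x"
  have MV: "y \<in> pverts G" if "y \<in> ?M" for y using that by (simp add: non_neighbors_def)
  have "\<forall>y\<in>?M. \<exists>y'. neighbors G y \<inter> ?M = {y'}" "\<forall>y\<in>?M. \<exists>w. non_neighbors G y \<inter> neighbors G x = {w}"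
    using matching[OF x] by (auto simp: card_1_singleton_iff)
  then obtain f g where fg: "\<forall>y\<in>?M. neighbors G y \<inter> ?M = {f y}"
      "\<forall>y\<in>?M. non_neighbors G y \<inter> neighbors G x = {g y}"
    by metis
  have f: "z \<in> neighbors G y \<and> z \<in> ?M \<longleftrightarrow> z = f y" if "y \<in> ?M" for y z
    using fg(1) that by (simp flip: Int_iff)
  have g: "z \<in> non_neighbors G y \<and> z \<in> neighbors G x \<longleftrightarrow> z = g y" if "y \<in> ?M" for y z
    using fg(2) that by (simp flip: Int_iff)
  have step: "g z = g y" if y: "y \<in> ?M" and z: "z \<in> ?M" "z \<noteq> y" "z \<noteq> f y" for y z
  proof -
    have gy: "g y \<in> non_neighbors G y" "g y \<in> neighbors G x" using g[OF y, of "g y"] by simp_all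
    have "z \<notin> neighbors G y" using f[OF y, of z] z by simp
    then have zy: "z \<in> non_neighbors G y" using z(2) MV[OF z(1)] by (simp add: non_neighbors_def)
    have xy: "x \<in> non_neighbors G y" by (rule non_neighbors_sym[OF x y])
    have "x \<in> neighbors G (g y)" using gy neighbors_sym by blast
    then have "neighbors G (g y) \<inter> non_neighbors G y = {x}"
      using xy matching(1)[OF MV[OF y] gy(1)]
      by (metis IntI card_1_singletonE singletonD)
    moreover have "z \<noteq> x" using z by (simp add: non_neighbors_def)
    ultimately have "z \<notin> neighbors G (g y)" using zy by blast
    then have "g y \<notin> neighbors G z" using neighbors_sym by blast
    moreover have "g y \<noteq> z" using z(1) gy(2) by (auto simp: non_neighbors_def)
    ultimately have "g y \<in> non_neighbors G z"
      using gy(1) by (simp add: non_neighbors_def)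
    then show ?thesis using g[OF z(1), of "g y"] gy(2) by simp
  qed
  have all: "g z = g y" if y: "y \<in> ?M" and z: "z \<in> ?M" for y z
  proof (cases "z = y \<or> z \<noteq> f y")
    case True
    with step[OF y z] show ?thesis by (cases "z = y") simp_all
  next
    case False
    have "\<not> ?M \<subseteq> {y, z}"
    proof
      assume "?M \<subseteq> {y, z}"
      then have "card ?M \<le> card {y, z}" by (intro card_mono) auto
      also have "\<dots> \<le> 2" by (simp add: card_insert_if)
      finally show False using m by simp
    qed
    then obtain t where t: "t \<in> ?M" "t \<noteq> y" "t \<noteq> z" by blast
    have "z \<in> neighbors G y" using f[OF y, of z] False by simp
    then have "y \<in> neighbors G z" using neighbors_sym by blast
    then have "f z = y" using f[OF z, of y] y by simp
    then have "g t = g z" using step[OF z t(1,3)] t(2) by simp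
    moreover have "g t = g y" using step[OF y t(1,2)] False t(3) by simp
    ultimately show ?thesis by simp
  qed
  obtain y where y: "y \<in> ?M" using m by fastforce
  let ?w = "g y"
  have w: "?w \<in> neighbors G x" using g[OF y, of ?w] by simp
  then have wV: "?w \<in> pverts G" using neighbors_subset by blast
  have "?M \<subseteq> non_neighbors G ?w"
  proof
    fix z assume z: "z \<in> ?M"
    then have "?w \<in> non_neighbors G z" using g[OF z, of ?w] all[OF y z] by simp
    then show "z \<in> non_neighbors G ?w" by (rule non_neighbors_sym[OF MV[OF z]])
  qed
  moreover have "card ?M = card (non_neighbors G ?w)"
    using card_eq_valency[OF x] card_eq_valency[OF wV] by simp
  ultimately have "?M = non_neighbors G ?w" by (intro card_subset_eq) auto
  with w show ?thesis by auto
qed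

text \<open>
  The non-neighbours of \<open>x\<close>, with \<open>x\<close> and its twin added, form a connected component of the
  complement, on which the graph itself induces a perfect matching.
\<close>

lemma ex_block:
  assumes x: "x \<in> pverts G" and m: "3 \<le> card (non_neighbors G x)"
  obtains C where "x \<in> C" "C \<subseteq> pverts G" "card C = card (non_neighbors G x) + 2"
    "\<And>v. v \<in> C \<Longrightarrow> card (neighbors G v \<inter> C) = 1"
    "\<And>v. v \<in> C \<Longrightarrow> pverts G - C \<subseteq> neighbors G v"
proof -
  let ?M = "non_neighbors G x"
  obtain w where w: "w \<in> neighbors G x" "non_neighbors G w = ?M"
    using ex_twin[OF x m] by blast
  have xw: "x \<in> neighbors G w" using w(1) neighbors_sym by blast
  have wx: "w \<noteq> x" using w(1) by auto
  have xM: "x \<notin> ?M" "w \<notin> ?M" using w(1) by (auto simp: non_neighbors_def)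
  have "neighbors G v \<inter> non_neighbors G v = {}" for v by (auto simp: non_neighbors_def)
  then have disj: "neighbors G x \<inter> ?M = {}" "neighbors G w \<inter> ?M = {}"
    using w(2) by metis+
  define C where "C = insert x (insert w ?M)"
  have CV: "C \<subseteq> pverts G"
    using x w(1) neighbors_subset by (auto simp: C_def non_neighbors_def)
  have cardC: "card C = card ?M + 2" using xM wx by (simp add: C_def)
  have one: "card (neighbors G v \<inter> C) = 1" if v: "v \<in> C" for v
  proof -
    consider "v = x" | "v = w" | "v \<in> ?M" using v by (auto simp: C_def)
    then show ?thesis
    proof cases
      case 1
      have "neighbors G x \<inter> C = {w}" using disj w(1) by (auto simp: C_def)
      with 1 show ?thesis by simp
    next
      case 2
      have "neighbors G w \<inter> C = {x}" using disj xw by (auto simp: C_def)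
      with 2 show ?thesis by simp
    next
      case 3
      then have "x \<notin> neighbors G v" "w \<notin> neighbors G v"
        using disj neighbors_sym by blast+
      then have "neighbors G v \<inter> C = neighbors G v \<inter> ?M" by (auto simp: C_def)
      with matching(1)[OF x 3] show ?thesis by simp
    qed
  qed
  have "pverts G - C \<subseteq> neighbors G v" if v: "v \<in> C" for v
  proof -
    have fC: "finite C" using CV pair_finite_verts finite_subset by blast
    have "card (neighbors G v - C) = k - 1"
      using one[OF v] regular CV v fC by (auto simp: card_Diff_subset_Int)
    moreover have "card (pverts G - C) = k - 1"
      using card_eq_valency[OF x] cardC CV fC by (simp add: card_Diff_subset)
    moreover have "neighbors G v - C \<subseteq> pverts G - C" using neighbors_subset by blast
    ultimately have "neighbors G v - C = pverts G - C"
      using pair_finite_verts by (intro card_subset_eq) auto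
    then show ?thesis by blast
  qed
  then show ?thesis using that[of C] CV cardC one by (auto simp: C_def)
qed

text \<open>
  With \<open>m \<ge> 3\<close> non-neighbours per vertex there are two disjoint blocks of size \<open>m + 2\<close>, completely
  joined to each other and to all other vertices. The difference of their characteristic functions is an
  eigenfunction for \<open>1 - (m + 2) \<le> -4\<close>, below the bound \<open>-3\<close>.
\<close>

lemma card_non_neighbors_le_2:
  assumes x: "x \<in> pverts G"
  shows "card (non_neighbors G x) \<le> 2"
proof (rule ccontr)
  let ?m = "card (non_neighbors G x)"
  assume "\<not> ?m \<le> 2"
  then have m: "3 \<le> ?m" by simp
  obtain C where C: "x \<in> C" "C \<subseteq> pverts G" "card C = ?m + 2"
    "\<And>v. v \<in> C \<Longrightarrow> card (neighbors G v \<inter> C) = 1"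
    "\<And>v. v \<in> C \<Longrightarrow> pverts G - C \<subseteq> neighbors G v"
    using ex_block[OF x m] by blast
  have k: "3 \<le> k" by (rule valency_ge_3[OF lam(2)])
  have "C \<noteq> pverts G" using C(3) card_eq_valency[OF x] k by auto
  then obtain y where y: "y \<in> pverts G" "y \<notin> C" using C(2) by blast
  have my: "card (non_neighbors G y) = ?m"
    using card_eq_valency[OF x] card_eq_valency[OF y(1)] by simp
  obtain D where D: "y \<in> D" "D \<subseteq> pverts G" "card D = ?m + 2"
    "\<And>v. v \<in> D \<Longrightarrow> card (neighbors G v \<inter> D) = 1"
    "\<And>v. v \<in> D \<Longrightarrow> pverts G - D \<subseteq> neighbors G v"
    using ex_block[OF y(1)] m unfolding my by blast
  have fin: "finite C" "finite D" using C(2) D(2) pair_finite_verts finite_subset by blast+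
  have disj: "C \<inter> D = {}"
  proof (rule ccontr)
    assume "C \<inter> D \<noteq> {}"
    then obtain v where v: "v \<in> C" "v \<in> D" by blast
    have "C - D \<subseteq> neighbors G v \<inter> C" using D(5)[OF v(2)] C(2) by blast
    then have "card (C - D) \<le> 1" using C(4)[OF v(1)] fin by (metis card_mono finite_Int)
    moreover have "\<not> C \<subseteq> D" using card_subset_eq[of D C] C(3) D(1,3) y(2) fin by auto
    then obtain p where p: "p \<in> C" "p \<notin> D" by blast
    have "C \<inter> D \<subseteq> neighbors G p \<inter> C"
      using D(5) p C(2) neighbors_sym by blast
    then have "card (C \<inter> D) \<le> 1" using C(4)[OF p(1)] fin by (metis card_mono finite_Int)
    moreover have "card C = card (C \<inter> D) + card (C - D)"
      using fin by (simp add: card_Int_Diff)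
    ultimately show False using C(3) m by simp
  qed
  define u where "u v = of_bool (v \<in> C) - (of_bool (v \<in> D) :: real)" for v
  have "(\<Sum>w \<in> neighbors G v. u w) = - (real ?m + 1) * u v" if v: "v \<in> pverts G" for v
  proof -
    have sum_u: "(\<Sum>w \<in> neighbors G v. u w) =
        real (card (neighbors G v \<inter> C)) - real (card (neighbors G v \<inter> D))"
      by (simp add: u_def sum_subtractf of_bool_def sum.If_cases)
    have out: "neighbors G v \<inter> B = B"
      if "v \<notin> B" "B \<subseteq> pverts G" "\<And>w. w \<in> B \<Longrightarrow> pverts G - B \<subseteq> neighbors G w" for B
      using that v neighbors_sym by blast
    have outC: "v \<notin> C \<Longrightarrow> card (neighbors G v \<inter> C) = ?m + 2"
      using out[of C] C(2,3,5) by simp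
    have outD: "v \<notin> D \<Longrightarrow> card (neighbors G v \<inter> D) = ?m + 2"
      using out[of D] D(2,3,5) by simp
    consider "v \<in> C" "v \<notin> D" | "v \<notin> C" "v \<in> D" | "v \<notin> C" "v \<notin> D" using disj by blast
    then show ?thesis
      unfolding sum_u by cases (simp_all add: u_def C(4) D(4) outC outD)
  qed
  moreover have "u x \<noteq> 0" using C(1) disj by (auto simp: u_def)
  ultimately have "eigenfunction G (- (real ?m + 1)) u"
    using x by (auto simp: eigenfunction_def)
  from smallest_eigenvalue_le[OF this] show False using lam(1) m by linarith
qed

text \<open>
  A vertex without non-neighbours makes the graph complete, with smallest eigenvalue \<open>-1\<close>; otherwise
  a non-neighbour of \<open>x\<close> comes with its partner in the matching.
\<close>

lemma card_eq_valency_plus_3: "card (pverts G) = k + 3"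
proof -
  obtain x where x: "x \<in> pverts G" using nonempty by blast
  have "non_neighbors G v \<noteq> {}" if v: "v \<in> pverts G" for v
  proof
    assume "non_neighbors G v = {}"
    then have n: "card (pverts G) = k + 1" using card_eq_valency[OF v] by simp
    have "non_neighbors G w = {}" if "w \<in> pverts G" for w
      using card_eq_valency[OF that] n by simp
    then have "smallest_eigenvalue G = real k - real (card (pverts G))"
      by (intro multipartite_smallest_eigenvalue) (use lam in auto)
    then show False using n lam(2) by simp
  qed
  then obtain y where y: "y \<in> non_neighbors G x" using x by blast
  obtain z where z: "neighbors G y \<inter> non_neighbors G x = {z}"
    using matching(1)[OF x y] by (auto simp: card_1_singleton_iff)
  then have "z \<in> non_neighbors G x" "z \<noteq> y" using neighbors_irrefl[of y] by blast+
  then have "card {y, z} \<le> card (non_neighbors G x)"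
    using y by (intro card_mono) auto
  then show ?thesis
    using card_non_neighbors_le_2[OF x] card_eq_valency[OF x] \<open>z \<noteq> y\<close> by simp
qed

text \<open>
  So the complement has no triangles, and its cycles have length at least four.
\<close>

lemma non_neighbors_adjacent:
  assumes x: "x \<in> pverts G" and y: "y \<in> non_neighbors G x" and z: "z \<in> non_neighbors G x" "z \<noteq> y"
  shows "z \<in> neighbors G y"
proof -
  have "card (non_neighbors G x) = 2"
    using card_eq_valency[OF x] card_eq_valency_plus_3 by simp
  then have "non_neighbors G x = {y, z}" using two_element_set y z by metis
  moreover have "neighbors G y \<inter> non_neighbors G x \<noteq> {}"
    using matching(1)[OF x y] by force
  ultimately obtain t where "t \<in> neighbors G y" "t = y \<or> t = z" by auto
  then show ?thesis by auto
qed

lemma cycle_length_ge_4: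
  assumes ps: "cyclic_listing (non_neighbors G) ps" and V: "set ps \<subseteq> pverts G"
  shows "4 \<le> length ps"
proof (rule ccontr)
  assume "\<not> 4 \<le> length ps"
  then have l: "length ps = 3" using ps by (simp add: cyclic_listing_def)
  have mem: "ps ! 0 \<in> pverts G" "ps ! 1 \<in> pverts G" using V l by auto
  have "ps ! 1 \<in> non_neighbors G (ps ! 0)" "ps ! 2 \<in> non_neighbors G (ps ! 0)"
    "ps ! 2 \<in> non_neighbors G (ps ! 1)"
    using cyclic_listing_mem_iff[OF ps, of 0 1] cyclic_listing_mem_iff[OF ps, of 0 2]
      cyclic_listing_mem_iff[OF ps, of 1 2] l by simp_all
  moreover have "ps ! 2 \<noteq> ps ! 1"
    using ps l by (simp add: cyclic_listing_def nth_eq_iff_index_eq)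
  ultimately have "ps ! 2 \<in> neighbors G (ps ! 1)"
    using non_neighbors_adjacent[OF mem(1)] by blast
  with \<open>ps ! 2 \<in> non_neighbors G (ps ! 1)\<close> show False by (simp add: non_neighbors_def)
qed

end

text \<open>
  The complement of the hexagon is the triangular prism, with smallest eigenvalue \<open>-2\<close>. The even and
  the odd positions form the two triangles, and opposite positions \<open>i\<close> and \<open>i + 3\<close> are matched. For \<open>\<theta> < -2\<close>
  the eigenvalue equations first make the sums over both triangles vanish, and then the values at matched
  vertices.
\<close>

lemma (in pair_graph) no_small_eigenvalue_complement_of_hexagon:
  assumes ps: "cyclic_listing (non_neighbors G) ps" and V: "set ps = pverts G" and l: "length ps = 6"
    and eig: "eigenfunction G \<theta> u" and \<theta>: "\<theta> < - 2"
  shows False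
proof -
  have d: "distinct ps" using ps by (simp add: cyclic_listing_def)
  have neq: "ps ! i = ps ! j \<longleftrightarrow> i = j" if "i < 6" "j < 6" for i j
    using d l that by (simp add: nth_eq_iff_index_eq)
  have Nset: "neighbors G (ps ! i) =
      (\<lambda>j. ps ! j) ` {j. j < 6 \<and> j \<noteq> i \<and> j \<noteq> (i + 1) mod 6 \<and> i \<noteq> (j + 1) mod 6}"
    (is "_ = _ ` ?J i") if i: "i < 6" for i
  proof -
    have ex: "\<exists>j<6. w = ps ! j" if "w \<in> neighbors G (ps ! i)" for w
    proof -
      have "w \<in> set ps" unfolding V using that neighbors_subset by blast
      then show ?thesis by (auto simp: in_set_conv_nth l)
    qed
    have mem: "ps ! j \<in> neighbors G (ps ! i) \<longleftrightarrow> j \<in> ?J i" if j: "j < 6" for j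
    proof -
      have "ps ! j \<in> pverts G" "ps ! i \<in> pverts G"
        using nth_mem[of j ps] nth_mem[of i ps] i j unfolding l V by blast+
      then have "ps ! j \<in> neighbors G (ps ! i) \<longleftrightarrow> ps ! j \<noteq> ps ! i \<and> ps ! j \<notin> non_neighbors G (ps ! i)"
        using neighbors_irrefl[of "ps ! i"] by (auto simp: non_neighbors_def)
      then show ?thesis
        using cyclic_listing_mem_iff[OF ps, of i j] i j l neq[OF j i] by simp
    qed
    show ?thesis
    proof
      show "neighbors G (ps ! i) \<subseteq> (\<lambda>j. ps ! j) ` ?J i"
      proof
        fix w assume w: "w \<in> neighbors G (ps ! i)"
        then obtain j where "j < 6" "w = ps ! j" using ex by blast
        with w mem[of j] show "w \<in> (\<lambda>j. ps ! j) ` ?J i" by simp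
      qed
      show "(\<lambda>j. ps ! j) ` ?J i \<subseteq> neighbors G (ps ! i)" using mem by auto
    qed
  qed
  define v where "v i = u (ps ! i)" for i
  have ev: "(\<Sum>j \<in> ?J i. v j) = \<theta> * v i" if i: "i < 6" for i
  proof -
    have "inj_on (\<lambda>j. ps ! j) (?J i)" using neq by (auto simp: inj_on_def)
    then have "(\<Sum>j \<in> ?J i. v j) = (\<Sum>w \<in> neighbors G (ps ! i). u w)"
      unfolding Nset[OF i] v_def by (simp add: sum.reindex)
    also have "\<dots> = \<theta> * v i"
      using eig V l i by (auto simp: eigenfunction_def v_def)
    finally show ?thesis .
  qed
  have six: "i < 6 \<longleftrightarrow> i = 0 \<or> i = 1 \<or> i = 2 \<or> i = 3 \<or> i = 4 \<or> i = 5" for i :: nat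
    by arith
  have J: "?J 0 = {2, 3, 4}" "?J 1 = {3, 4, 5}" "?J 2 = {0, 4, 5}" "?J 3 = {0, 1, 5}"
    "?J 4 = {0, 1, 2}" "?J 5 = {1, 2, 3}"
  proof -
    have *: "{j. j < 6 \<and> P j} = set (filter P [0, 1, 2, 3, 4, 5])" for P :: "nat \<Rightarrow> bool"
      by (simp only: six set_filter list.set insert_iff empty_iff simp_thms)
    show "?J 0 = {2, 3, 4}" "?J 1 = {3, 4, 5}" "?J 2 = {0, 4, 5}" "?J 3 = {0, 1, 5}"
      "?J 4 = {0, 1, 2}" "?J 5 = {1, 2, 3}"
      unfolding * by simp_all
  qed
  have e: "v 2 + v 3 + v 4 = \<theta> * v 0" "v 3 + v 4 + v 5 = \<theta> * v 1" "v 0 + v 4 + v 5 = \<theta> * v 2"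
    "v 0 + v 1 + v 5 = \<theta> * v 3" "v 0 + v 1 + v 2 = \<theta> * v 4" "v 1 + v 2 + v 3 = \<theta> * v 5"
    using ev[of 0] ev[of 1] ev[of 2] ev[of 3] ev[of 4] ev[of 5] unfolding J by simp_all
  define S T where "S = v 0 + v 2 + v 4" and "T = v 1 + v 3 + v 5"
  have "2 * S + T = \<theta> * S" "2 * T + S = \<theta> * T"
    using e by (simp_all add: S_def T_def algebra_simps)
  then have ST: "(\<theta> - 3) * (S + T) = 0" "(\<theta> - 1) * (S - T) = 0"
    by (simp_all add: algebra_simps)
  then have "S + T = 0" "S - T = 0" using \<theta> by simp_all
  then have S: "S = 0" and T: "T = 0" by simp_all
  have pair: "a = 0 \<and> b = 0" if "b = (\<theta> + 1) * a" "a = (\<theta> + 1) * b" for a b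
  proof -
    have "(\<theta> + 2) * \<theta> * a = (\<theta> + 1) * ((\<theta> + 1) * a) - a" by (simp add: algebra_simps)
    also have "\<dots> = 0" using that by simp
    finally have "a = 0" using \<theta> by simp
    with that(1) show ?thesis by simp
  qed
  have "v 0 = 0 \<and> v 3 = 0" "v 2 = 0 \<and> v 5 = 0" "v 4 = 0 \<and> v 1 = 0"
    by (rule pair; use e S T in \<open>simp add: S_def T_def algebra_simps\<close>)+
  then have "v i = 0" if "i < 6" for i
    using that unfolding six by (elim disjE) simp_all
  moreover obtain x where "x \<in> pverts G" "u x \<noteq> 0" using eig by (auto simp: eigenfunction_def)
  ultimately show False
    using l unfolding V[symmetric] by (auto simp: in_set_conv_nth v_def)
qed

context diameter_two_graph
begin

text \<open>
  Six vertices with cycles of length at least four in the complement leave only the hexagon.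
\<close>

lemma complement_of_cycles_iso:
  "7 \<le> card (pverts G) \<and> (\<exists>ls. (\<forall>l \<in> set ls. 4 \<le> l) \<and>
     graph_iso G (graph_complement (disjoint_union (map cycle_graph ls))))"
proof -
  obtain pss where pss: "distinct (concat pss)" "set (concat pss) = pverts G"
      and cyc: "\<forall>ps \<in> set pss. cyclic_listing (non_neighbors G) ps"
    using cycle_decomposition[OF complement_two_regular[OF card_eq_valency_plus_3]] by blast
  have len: "4 \<le> length ps" if "ps \<in> set pss" for ps
  proof -
    have "set ps \<subseteq> pverts G" unfolding pss(2)[symmetric] using that by auto
    then show ?thesis using cycle_length_ge_4 cyc that by blast
  qed
  have k: "3 \<le> k" by (rule valency_ge_3[OF lam(2)])
  have "7 \<le> card (pverts G)"
  proof (rule ccontr)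
    assume "\<not> 7 \<le> card (pverts G)"
    then have n: "card (pverts G) = 6" using card_eq_valency_plus_3 k by simp
    have total: "length (concat pss) = 6" using pss n distinct_card by metis
    obtain ps qss where "pss = ps # qss" using total by (cases pss) auto
    moreover have "qss = []"
    proof (cases qss)
      case (Cons qs rss)
      then have "8 \<le> length (concat pss)"
        using len[of ps] len[of qs] \<open>pss = ps # qss\<close> by simp
      then show ?thesis using total by simp
    qed simp
    ultimately have ps: "pss = [ps]" by simp
    obtain u where "eigenfunction G (smallest_eigenvalue G) u"
      by (rule smallest_eigenvalue_eigenfunction)
    then show False
      using no_small_eigenvalue_complement_of_hexagon[of ps _ u] cyc pss(2) total lam(2) ps by simp
  qed
  moreover have "\<forall>l \<in> set (map length pss). 4 \<le> l" using len by auto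
  ultimately show ?thesis using iso_complement_of_cycles[OF pss cyc] by blast
qed

end

text \<open>
  Otherwise the vertices within distance two of \<open>x\<close> would be closed under adjacency and hence be all
  vertices, but \<open>y\<close> is not among them.
\<close>

lemma (in sesqui_regular_graph) far_pair:
  assumes "x \<in> pverts G" "y \<in> non_neighbors G x" "neighbors G x \<inter> neighbors G y = {}"
  obtains a b z where "a \<in> neighbors G x" "b \<in> neighbors G a" "z \<in> neighbors G b"
    "x \<noteq> z" "z \<notin> neighbors G x" "neighbors G x \<inter> neighbors G z = {}"
proof (rule ccontr)
  assume no: "\<not> thesis"
  let ?S = "insert x (neighbors G x) \<union> {b \<in> pverts G. neighbors G x \<inter> neighbors G b \<noteq> {}}"
  have "?S = pverts G"
  proof (rule connected_closed_set[OF conn])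
    fix b assume "b \<in> ?S"
    show "neighbors G b \<subseteq> ?S"
    proof
      fix z assume z: "z \<in> neighbors G b"
      then have zV: "z \<in> pverts G" using neighbors_subset by blast
      consider "b = x" | "b \<in> neighbors G x" | a where "a \<in> neighbors G x" "a \<in> neighbors G b"
        using \<open>b \<in> ?S\<close> by blast
      then show "z \<in> ?S"
      proof cases
        case 1
        with z show ?thesis by blast
      next
        case 2
        with z zV neighbors_sym show ?thesis by blast
      next
        case (3 a)
        then have "b \<in> neighbors G a" using neighbors_sym by blast
        with 3 z no that have "x = z \<or> z \<in> neighbors G x \<or> neighbors G x \<inter> neighbors G z \<noteq> {}"
          by blast
        with zV show ?thesis by blast
      qed
    qed
  qed (use assms neighbors_subset in auto)
  with assms show False by (auto simp: non_neighbors_def)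
qed

section \<open>The classification\<close>

theorem theorem1p6:
  fixes G :: "'a pair_pre_digraph" and n k c :: nat
  assumes "pair_graph G"
    and "Digraph_Component.connected (with_proj G)"
    and "sesqui_regular G n k c"
    and "- 3 \<le> smallest_eigenvalue G" and "smallest_eigenvalue G < - 2"
  shows "(c = k \<longrightarrow>
            6 \<le> n \<and> 3 dvd n \<and>
            graph_iso G (complete_multipartite (n div 3) 3) \<and>
            graph_iso G (graph_complement (disjoint_union (replicate (n div 3) (cycle_graph 3))))) \<and>
         (int c = int k - 1 \<longrightarrow>
            7 \<le> n \<and>
            ((\<exists>ls. (\<forall>l \<in> set ls. 4 \<le> l) \<and>
                   graph_iso G (graph_complement (disjoint_union (map cycle_graph ls)))) \<or>
             graph_iso G (hypercube 3))) \<and>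
         (c = k \<or> int c = int k - 1 \<longrightarrow> s_integrable 1 G)"
proof -
  interpret pair_graph G by fact
  have n: "card (pverts G) = n" using assms(3) by (simp add: sesqui_regular_def)
  interpret sesqui_regular_graph G k c
  proof
    show "card (neighbors G x) = k" if "x \<in> pverts G" for x
      using assms(3) that out_degree_eq_card_neighbors by (simp add: sesqui_regular_def)
    show "pverts G \<noteq> {}"
      using assms(2) by (simp add: Digraph_Component.connected_def strongly_connected_def)
  qed (use assms(2,3) in \<open>auto simp: sesqui_regular_def\<close>)
  note lam = assms(4,5)
  have ceil: "\<lceil>- smallest_eigenvalue G\<rceil> = 3"
    using lam by (simp add: ceiling_eq_iff)
  have 1: "6 \<le> n \<and> 3 dvd n \<and> graph_iso G (complete_multipartite (n div 3) 3) \<and>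
      graph_iso G (graph_complement (disjoint_union (replicate (n div 3) (cycle_graph 3)))) \<and>
      s_integrable 1 G" if c: "c = k"
  proof -
    obtain p where p: "n = 3 * p" "2 \<le> p"
      and iso: "graph_iso G (graph_complement (disjoint_union (replicate p (cycle_graph 3))))"
      using complement_of_triangles_iso[OF c lam] n by auto
    have "graph_iso G (graph_complement (disjoint_union (map cycle_graph (replicate p 3))))"
      using iso by (simp add: map_replicate)
    then have "s_integrable 1 G"
      by (rule integrable_complement_of_cycles[OF pair_wf_digraph_axioms _ _ ceil]) auto
    with p iso show ?thesis by (simp add: complement_of_triangles)
  qed
  have 2: "7 \<le> n \<and> ((\<exists>ls. (\<forall>l \<in> set ls. 4 \<le> l) \<and>
        graph_iso G (graph_complement (disjoint_union (map cycle_graph ls)))) \<or>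
        graph_iso G (hypercube 3)) \<and> s_integrable 1 G" if "int c = int k - 1"
  proof (cases "\<exists>x \<in> pverts G. \<exists>y \<in> non_neighbors G x. neighbors G x \<inter> neighbors G y = {}")
    case True
    have c: "c + 1 = k" using that by simp
    obtain a b x z where "a \<in> neighbors G x" "b \<in> neighbors G a" "z \<in> neighbors G b"
        "x \<noteq> z" "z \<notin> neighbors G x" "neighbors G x \<inter> neighbors G z = {}"
      using True far_pair by metis
    then have cube: "k = 3" "graph_iso G (hypercube 3)"
      using antipodal_iso_hypercube[OF c lam] by blast+
    obtain \<phi> where "bij_betw \<phi> (pverts G) (pverts (hypercube 3))"
      using graph_isoE[OF cube(2) pair_wf_digraph_axioms] by blast
    then have "n = card {p :: bool list. length p = 3}"
      using n bij_betw_same_card by (fastforce simp: hypercube_def)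
    also have "\<dots> = 8" using card_lists_length_eq[of "UNIV :: bool set" 3] by simp
    finally show ?thesis using cube integrable_incidence ceil by simp
  next
    case False
    interpret diameter_two_graph G k c
      by unfold_locales (use that False lam in auto)
    obtain ls where ls: "\<forall>l \<in> set ls. 4 \<le> l"
        "graph_iso G (graph_complement (disjoint_union (map cycle_graph ls)))"
      and n7: "7 \<le> n"
      using complement_of_cycles_iso n by blast
    have "s_integrable 1 G"
      by (rule integrable_complement_of_cycles[OF pair_wf_digraph_axioms ls(2) _ ceil])
        (use ls(1) in force)
    with ls n7 show ?thesis by blast
  qed
  show ?thesis using 1 2 by blast
qed

end
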